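(* Let $q\in(0,1)$ and $\alpha\in(0,2]$. For a finite interval $\Lambda\subset\mathbb{Z}$ let $C_\alpha(\Lambda)$ be the best possible (i.e. the smallest) constant in the $\alpha$-log-Sobolev inequality for the East process on $\Lambda$. Then there exists a constant $c\in(0,\infty)$, which may depend on $q$ and $\alpha$ but not on $\Lambda$, such that for every (non-empty) finite interval $\Lambda\subset \mathbb{Z}$ $$\frac1c\,|\Lambda|\;\le\; C_\alpha(\Lambda)\;\le\; c\,|\Lambda| .$$
   Context: Let $q\in(0,1)$, $p=1-q$. For a finite interval $\Lambda=[a,b]\subset\mathbb{Z}$ (integer points) let $\Omega_\Lambda=\{0,1\}^\Lambda$ and let $\pi_\Lambda$ be the product of Bernoulli$(1-q)$ measures on $\Omega_\Lambda$ (so $\pi_\Lambda(\sigma(x)=1)=p$, $\pi_\Lambda(\sigma(x)=0)=q$). $|\Lambda|$ is the number of sites of $\Lambda$. East constraint with a frozen zero at $b+1$: $c_x^\Lambda(\sigma)=1-\sigma(x+1)$ for $x\in\Lambda\setminus\{b\}$ and $c_b^\Lambda(\sigma)=1$. For $\sigma\in\Omega_\Lambda$ and $x\in\Lambda$, $\sigma^x$ is the configuration obtained from $\sigma$ by replacing $\sigma(x)$ with $1-\sigma(x)$. The Dirichlet form of the East process on $\Lambda$ is $$\mathcal{D}_\Lambda(f,g)=\frac12\sum_{x\in\Lambda}\sum_{\sigma\in\Omega_\Lambda}\pi_\Lambda(\sigma)\,c_x^\Lambda(\sigma)\,[(1-\sigma(x))p+\sigma(x)q]\,(f(\sigma^x)-f(\sigma))(g(\sigma^x)-g(\sigma)).$$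 For $f>0$, $\mathrm{Ent}_\Lambda(f)=\pi_\Lambda\big(f\log(f/\pi_\Lambda(f))\big)$, where $\pi_\Lambda(f)$ is the mean of $f$ under $\pi_\Lambda$. The $\alpha$-log-Sobolev inequality with constant $C$: for $\alpha\in(0,2]\setminus\{1\}$, with $\alpha'$ defined by $\frac1\alpha+\frac1{\alpha'}=1$ (possibly $\alpha'<0$), it is $$\mathrm{Ent}_\Lambda(f)\le \frac{\alpha\alpha' C}{4}\,\mathcal{D}_\Lambda(f^{1/\alpha},f^{1/\alpha'})\qquad\text{for all } f:\Omega_\Lambda\to(0,\infty);$$ for $\alpha=1$ (the limiting case) it is $$\mathrm{Ent}_\Lambda(f)\le \frac{C}{4}\,\mathcal{D}_\Lambda(f,\log f)\qquad\text{for all } f:\Omega_\Lambda\to(0,\infty).$$ *)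

theory Defs
  imports "HOL-Probability.Probability"
begin

text \<open>
  The finite interval with endpoints \<open>a \<le> b\<close> is the set \<open>{a..b}\<close> of integers.  A configuration is
  a Boolean function, extensional outside the interval, with \<open>True\<close> for occupation number 1 and
  \<open>False\<close> for occupation number 0.
\<close>

definition configs :: "int \<Rightarrow> int \<Rightarrow> (int \<Rightarrow> bool) set" where
  "configs a b = {a..b} \<rightarrow>\<^sub>E UNIV"

definition east_pmf :: "real \<Rightarrow> int \<Rightarrow> int \<Rightarrow> (int \<Rightarrow> bool) pmf" where
  "east_pmf q a b = Pi_pmf {a..b} undefined (\<lambda>_. bernoulli_pmf (1 - q))"

definition east_mean :: "real \<Rightarrow> int \<Rightarrow> int \<Rightarrow> ((int \<Rightarrow> bool) \<Rightarrow> real) \<Rightarrow> real" where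
  "east_mean q a b f = measure_pmf.expectation (east_pmf q a b) f"

definition east_constraint :: "int \<Rightarrow> int \<Rightarrow> (int \<Rightarrow> bool) \<Rightarrow> real" where
  "east_constraint b x \<sigma> = (if x = b then 1 else 1 - of_bool (\<sigma> (x + 1)))"

definition flip :: "int \<Rightarrow> (int \<Rightarrow> bool) \<Rightarrow> (int \<Rightarrow> bool)" where
  "flip x \<sigma> = \<sigma>(x := \<not> \<sigma> x)"

definition east_dirichlet ::
  "real \<Rightarrow> int \<Rightarrow> int \<Rightarrow> ((int \<Rightarrow> bool) \<Rightarrow> real) \<Rightarrow> ((int \<Rightarrow> bool) \<Rightarrow> real) \<Rightarrow> real" where
  "east_dirichlet q a b f g =
     1 / 2 * (\<Sum>x\<in>{a..b}. \<Sum>\<sigma>\<in>configs a b.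
       pmf (east_pmf q a b) \<sigma> * east_constraint b x \<sigma>
       * ((1 - of_bool (\<sigma> x)) * (1 - q) + of_bool (\<sigma> x) * q)
       * (f (flip x \<sigma>) - f \<sigma>) * (g (flip x \<sigma>) - g \<sigma>))"

definition east_entropy :: "real \<Rightarrow> int \<Rightarrow> int \<Rightarrow> ((int \<Rightarrow> bool) \<Rightarrow> real) \<Rightarrow> real" where
  "east_entropy q a b f = east_mean q a b (\<lambda>\<sigma>. f \<sigma> * ln (f \<sigma> / east_mean q a b f))"

text \<open>The solution \<open>\<alpha>'\<close> of \<open>1/\<alpha> + 1/\<alpha>' = 1\<close>; it is negative for \<open>0 < \<alpha> < 1\<close>.\<close>

definition conj_exponent :: "real \<Rightarrow> real" where
  "conj_exponent \<alpha> = \<alpha> / (\<alpha> - 1)"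

lemma conj_exponent_iff:
  assumes "\<alpha> \<noteq> 0" "\<alpha> \<noteq> 1"
  shows "1 / \<alpha> + 1 / \<alpha>' = 1 \<longleftrightarrow> \<alpha>' = conj_exponent \<alpha>"
proof
  assume *: "1 / \<alpha> + 1 / \<alpha>' = 1"
  then have "\<alpha>' \<noteq> 0" using assms by auto
  then have "\<alpha>' * (\<alpha> - 1) = \<alpha>" using * assms by (simp add: field_simps)
  then show "\<alpha>' = conj_exponent \<alpha>"
    using assms by (simp add: conj_exponent_def eq_divide_eq)
next
  assume "\<alpha>' = conj_exponent \<alpha>"
  then have "1 / \<alpha>' = (\<alpha> - 1) / \<alpha>" by (simp add: conj_exponent_def)
  then show "1 / \<alpha> + 1 / \<alpha>' = 1" using assms by (simp add: diff_divide_distrib)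
qed

definition alpha_log_sobolev :: "real \<Rightarrow> real \<Rightarrow> int \<Rightarrow> int \<Rightarrow> real \<Rightarrow> bool" where
  "alpha_log_sobolev q \<alpha> a b C \<longleftrightarrow>
     (\<forall>f. (\<forall>\<sigma>\<in>configs a b. f \<sigma> > 0) \<longrightarrow>
        east_entropy q a b f \<le>
          (if \<alpha> = 1 then C / 4 * east_dirichlet q a b f (\<lambda>\<sigma>. ln (f \<sigma>))
           else \<alpha> * conj_exponent \<alpha> * C / 4
                  * east_dirichlet q a b (\<lambda>\<sigma>. f \<sigma> powr (1 / \<alpha>))
                                         (\<lambda>\<sigma>. f \<sigma> powr (1 / conj_exponent \<alpha>))))"

text \<open>
  A relation rather than a function, so that asserting it of some \<open>C\<close> includes that a finite
  smallest constant exists.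
\<close>

definition best_log_sobolev_const :: "real \<Rightarrow> real \<Rightarrow> int \<Rightarrow> int \<Rightarrow> real \<Rightarrow> bool" where
  "best_log_sobolev_const q \<alpha> a b C \<longleftrightarrow>
     alpha_log_sobolev q \<alpha> a b C \<and> (\<forall>C'. alpha_log_sobolev q \<alpha> a b C' \<longrightarrow> C \<le> C')"

lemma best_log_sobolev_const_unique:
  assumes "best_log_sobolev_const q \<alpha> a b C" "best_log_sobolev_const q \<alpha> a b C'"
  shows "C = C'"
  using assms by (auto simp: best_log_sobolev_const_def intro: antisym)

end

theory Submission
  imports Defs "HOL-Real_Asymp.Real_Asymp"
begin

text \<open>
  Upper bound.  The spectral gap is bounded below uniformly in the interval: expand the variance
  into martingale increments, averaging over the sites to the right of \<open>x\<close>.  The nearest zero among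
  the \<open>l\<close> sites to the right of \<open>x\<close> makes the flip at \<open>x\<close> reachable by a bounded number of legal
  flips; the event that there is no such zero contributes at most a multiple \<open>l (1 - q / 2)^l\<close> of the
  variance, which is absorbed for large \<open>l\<close>.  Since every configuration has probability at least
  \<open>min q (1 - q) ^ |\<Lambda>|\<close>, the entropy of \<open>f\<close> is at most a multiple of \<open>|\<Lambda>|\<close> times the variance of
  \<open>sqrt f\<close>, and the Dirichlet form of \<open>sqrt f\<close> is bounded by every \<open>\<alpha>\<close>-form.

  Lower bound.  Test with \<open>f = r ^ k\<close>, where \<open>k\<close> is the length of the initial run of ones.  The
  constraint lets \<open>k\<close> change only by one unit at a time, so the \<open>\<alpha>\<close>-form is at most a constant times the
  mean of \<open>f\<close>, but for large \<open>r\<close> the measure with density proportional to \<open>f\<close> sits near the all-ones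
  configuration and has relative entropy of order \<open>|\<Lambda>|\<close>.
\<close>

section \<open>Single-site operators and the Dirichlet form\<close>

text \<open>Conditional expectation given all sites other than \<open>x\<close>; the result no
  longer depends on \<open>\<sigma> x\<close>.\<close>

definition site_mean :: "real \<Rightarrow> int \<Rightarrow> ((int \<Rightarrow> bool) \<Rightarrow> real) \<Rightarrow> (int \<Rightarrow> bool) \<Rightarrow> real" where
  "site_mean q x F \<sigma> = (1 - q) * F (\<sigma>(x := True)) + q * F (\<sigma>(x := False))"

text \<open>Oriented, unlike the difference along a flip, so that it does not depend on
  \<open>\<sigma> x\<close> and commutes with averages over other sites.\<close>

definition site_diff :: "int \<Rightarrow> ((int \<Rightarrow> bool) \<Rightarrow> real) \<Rightarrow> (int \<Rightarrow> bool) \<Rightarrow> real" where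
  "site_diff x F \<sigma> = F (\<sigma>(x := True)) - F (\<sigma>(x := False))"

text \<open>The last term is the variance of a variable taking two values with probabilities
  \<open>1 - q\<close> and \<open>q\<close>.\<close>

lemma site_mean_square:
  "site_mean q x (\<lambda>\<sigma>. (F \<sigma>)\<^sup>2) \<sigma> = (site_mean q x F \<sigma>)\<^sup>2 + q * (1 - q) * (site_diff x F \<sigma>)\<^sup>2"
  by (simp add: site_mean_def site_diff_def power2_eq_square algebra_simps)

lemma site_diff_site_mean:
  "x \<noteq> y \<Longrightarrow> site_diff x (site_mean q y F) = site_mean q y (site_diff x F)"
  by (rule ext) (simp add: site_mean_def site_diff_def fun_upd_twist algebra_simps)

lemma configs_upd: "\<sigma> \<in> configs a b \<Longrightarrow> x \<in> {a..b} \<Longrightarrow> \<sigma>(x := v) \<in> configs a b"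
  by (auto simp: configs_def PiE_iff extensional_def)

lemma configs_outside: "\<sigma> \<in> configs a b \<Longrightarrow> x \<notin> {a..b} \<Longrightarrow> \<sigma> x = undefined"
  by (auto simp: configs_def PiE_iff extensional_def)

lemma finite_configs: "finite (configs a b)"
  unfolding configs_def by (rule finite_PiE) auto

section \<open>Expectations and the Dirichlet form on one interval\<close>

locale east_interval =
  fixes q :: real and a b :: int
  assumes q_pos: "0 < q" and q_less_1: "q < 1" and a_le_b: "a \<le> b"
begin

abbreviation "E \<equiv> east_mean q a b"

abbreviation constr :: "int \<Rightarrow> (int \<Rightarrow> bool) \<Rightarrow> real" where
  "constr \<equiv> east_constraint b"

lemma set_east_pmf: "set_pmf (east_pmf q a b) = configs a b"
  using q_pos q_less_1
  by (auto simp: east_pmf_def configs_def set_Pi_pmf PiE_dflt_def PiE_iff extensional_def set_pmf_bernoulli)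

lemma pmf_east: "\<sigma> \<in> configs a b \<Longrightarrow>
    pmf (east_pmf q a b) \<sigma> = (\<Prod>x\<in>{a..b}. if \<sigma> x then 1 - q else q)"
  unfolding east_pmf_def using q_pos q_less_1
  by (subst pmf_Pi) (auto simp: configs_outside intro!: prod.cong)

lemma E_eq_sum: "E F = (\<Sum>\<sigma>\<in>configs a b. pmf (east_pmf q a b) \<sigma> * F \<sigma>)"
  unfolding east_mean_def
  by (subst integral_measure_pmf_real[OF finite_configs[of a b]]) (auto simp: set_east_pmf mult.commute)

lemma E_mono: "(\<And>\<sigma>. \<sigma> \<in> configs a b \<Longrightarrow> F \<sigma> \<le> G \<sigma>) \<Longrightarrow> E F \<le> E G"
  unfolding E_eq_sum by (intro sum_mono mult_left_mono) auto

lemma E_cong: "(\<And>\<sigma>. \<sigma> \<in> configs a b \<Longrightarrow> F \<sigma> = G \<sigma>) \<Longrightarrow> E F = E G"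
  unfolding E_eq_sum by (intro sum.cong) auto

lemma E_add: "E (\<lambda>\<sigma>. F \<sigma> + G \<sigma>) = E F + E G"
  unfolding E_eq_sum by (simp only: sum.distrib distrib_left)

lemma E_diff: "E (\<lambda>\<sigma>. F \<sigma> - G \<sigma>) = E F - E G"
  unfolding E_eq_sum by (simp only: sum_subtractf right_diff_distrib)

lemma E_cmult: "E (\<lambda>\<sigma>. c * F \<sigma>) = c * E F"
  unfolding E_eq_sum by (simp only: sum_distrib_left mult.left_commute)

lemma E_multc: "E (\<lambda>\<sigma>. F \<sigma> * c) = E F * c"
  using E_cmult[of c F] by (simp add: mult.commute)

lemma E_const [simp]: "E (\<lambda>\<sigma>. c) = c"
  unfolding east_mean_def by simp

lemma E_sum: "E (\<lambda>\<sigma>. \<Sum>i\<in>I. F i \<sigma>) = (\<Sum>i\<in>I. E (F i))"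
  unfolding E_eq_sum sum_distrib_left by (rule sum.swap)

lemma E_nonneg: "(\<And>\<sigma>. \<sigma> \<in> configs a b \<Longrightarrow> 0 \<le> F \<sigma>) \<Longrightarrow> 0 \<le> E F"
  using E_mono[of "\<lambda>_. 0" F] by simp

lemma configs_nonempty: "configs a b \<noteq> {}"
  by (simp add: configs_def PiE_eq_empty_iff)

lemma pmf_east_pos: "\<sigma> \<in> configs a b \<Longrightarrow> 0 < pmf (east_pmf q a b) \<sigma>"
  by (simp add: pmf_positive_iff set_east_pmf)

lemma E_pos: "(\<And>\<sigma>. \<sigma> \<in> configs a b \<Longrightarrow> 0 < F \<sigma>) \<Longrightarrow> 0 < E F"
  unfolding E_eq_sum by (rule sum_pos[OF finite_configs configs_nonempty]) (simp add: pmf_east_pos)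

text \<open>Tower property. Splitting the site \<open>x\<close> off the product measure turns
  \<open>E G\<close> into the mean of \<open>site_mean q x G\<close> over the remaining sites, and
  \<open>site_mean q x\<close> is idempotent.\<close>

lemma E_site_mean:
  assumes "x \<in> {a..b}"
  shows "E (site_mean q x F) = E F"
proof -
  define A where "A = {a..b} - {x}"
  define Q where "Q = Pi_pmf A undefined (\<lambda>_. bernoulli_pmf (1 - q))"
  have A: "insert x A = {a..b}" "finite A" "x \<notin> A" using assms by (auto simp: A_def)
  have pmf: "east_pmf q a b = bernoulli_pmf (1 - q) \<bind> (\<lambda>y. map_pmf (\<lambda>f. f(x := y)) Q)"
    unfolding east_pmf_def A(1)[symmetric] using A(2,3)
    by (simp add: Pi_pmf_insert' Q_def map_pmf_def)
  have finQ: "finite (set_pmf Q)"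
    unfolding Q_def using A(2) by (auto simp: set_Pi_pmf intro!: finite_PiE_dflt)
  have intQ: "integrable (measure_pmf Q) g" for g :: "_ \<Rightarrow> real"
    by (rule integrable_measure_pmf_finite[OF finQ])
  have *: "E G = measure_pmf.expectation Q (site_mean q x G)" for G
  proof -
    have "E G = (\<Sum>y\<in>UNIV. pmf (bernoulli_pmf (1 - q)) y *\<^sub>R
        measure_pmf.expectation (map_pmf (\<lambda>f. f(x := y)) Q) G)"
      unfolding east_mean_def pmf using finQ by (subst pmf_expectation_bind[where A = UNIV]) auto
    also have "\<dots> = measure_pmf.expectation Q (site_mean q x G)"
      using q_pos q_less_1 by (simp add: UNIV_bool site_mean_def[abs_def] intQ)
    finally show ?thesis .
  qed
  have "site_mean q x (site_mean q x F) = site_mean q x F"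
    by (rule ext) (simp add: site_mean_def algebra_simps)
  then show ?thesis unfolding * by simp
qed

lemma constr_nonneg: "0 \<le> constr x \<sigma>" and constr_le_1: "constr x \<sigma> \<le> 1"
  by (auto simp: east_constraint_def)

lemma constr_upd: "y \<noteq> x + 1 \<Longrightarrow> constr x (\<sigma>(y := v)) = constr x \<sigma>"
  by (auto simp: east_constraint_def)

text \<open>Reversibility: the weight \<open>1 - q\<close> of a one times its flip rate
  \<open>q\<close> equals the weight \<open>q\<close> of a zero times its rate \<open>1 - q\<close>.
  The two values at \<open>x\<close> thus contribute equally, which cancels the factor 1/2; the
  constraint does not depend on \<open>\<sigma> x\<close>.\<close>

lemma dirichlet_eq:
  "east_dirichlet q a b F G = q * (1 - q) * (\<Sum>x\<in>{a..b}. E (\<lambda>\<sigma>. constr x \<sigma> * (site_diff x F \<sigma> * site_diff x G \<sigma>)))"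
proof -
  have "E (\<lambda>\<sigma>. constr x \<sigma> * ((1 - of_bool (\<sigma> x)) * (1 - q) + of_bool (\<sigma> x) * q)
       * (F (flip x \<sigma>) - F \<sigma>) * (G (flip x \<sigma>) - G \<sigma>))
     = 2 * q * (1 - q) * E (\<lambda>\<sigma>. constr x \<sigma> * (site_diff x F \<sigma> * site_diff x G \<sigma>))"
    (is "E ?L = _") if "x \<in> {a..b}" for x
  proof -
    have "E ?L = E (site_mean q x ?L)" using E_site_mean[OF that] by simp
    also have "\<dots> = E (\<lambda>\<sigma>. 2 * q * (1 - q) * (constr x \<sigma> * (site_diff x F \<sigma> * site_diff x G \<sigma>)))"
    proof (intro E_cong)
      fix \<sigma>
      define c F1 F0 G1 G0 where "c = constr x \<sigma>" and "F1 = F (\<sigma>(x := True))" and "F0 = F (\<sigma>(x := False))"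
        and "G1 = G (\<sigma>(x := True))" and "G0 = G (\<sigma>(x := False))"
      have "site_mean q x ?L \<sigma> = (1 - q) * (c * q * (F0 - F1) * (G0 - G1)) + q * (c * (1 - q) * (F1 - F0) * (G1 - G0))"
        by (simp add: site_mean_def flip_def constr_upd c_def F1_def F0_def G1_def G0_def)
      also have "\<dots> = 2 * q * (1 - q) * (c * ((F1 - F0) * (G1 - G0)))"
        by (simp add: algebra_simps)
      finally show "site_mean q x ?L \<sigma> = 2 * q * (1 - q) * (constr x \<sigma> * (site_diff x F \<sigma> * site_diff x G \<sigma>))"
        by (simp only: site_diff_def c_def F1_def F0_def G1_def G0_def)
    qed
    finally show ?thesis by (simp only: E_cmult)
  qed
  note * = this
  have "east_dirichlet q a b F G = 1 / 2 * (\<Sum>x\<in>{a..b}. E (\<lambda>\<sigma>. constr x \<sigma> * ((1 - of_bool (\<sigma> x)) * (1 - q) + of_bool (\<sigma> x) * q)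
       * (F (flip x \<sigma>) - F \<sigma>) * (G (flip x \<sigma>) - G \<sigma>)))"
    unfolding east_dirichlet_def E_eq_sum by (simp only: mult.assoc)
  also have "\<dots> = 1 / 2 * (\<Sum>x\<in>{a..b}. 2 * q * (1 - q) * E (\<lambda>\<sigma>. constr x \<sigma> * (site_diff x F \<sigma> * site_diff x G \<sigma>)))"
    by (intro arg_cong2[of _ _ _ _ "(*)"] sum.cong * refl)
  also have "\<dots> = q * (1 - q) * (\<Sum>x\<in>{a..b}. E (\<lambda>\<sigma>. constr x \<sigma> * (site_diff x F \<sigma> * site_diff x G \<sigma>)))"
    by (simp only: sum_distrib_left[symmetric])
  finally show ?thesis .
qed

end

section \<open>Uniform spectral gap\<close>

text \<open>Constants of the induction in \<open>propagate_zero\<close>: in \<open>2 / q\<close> the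
  2 comes from squaring a sum and \<open>1 / q\<close> from forcing a zero; the additive term pays
  for the flip at the new site.\<close>

primrec propagation_const :: "real \<Rightarrow> nat \<Rightarrow> real" where
  "propagation_const q 0 = 1"
| "propagation_const q (Suc n) = 2 / q * propagation_const q n + 4 / min q (1 - q)"

lemma propagation_const_ge_1:
  assumes "0 < q" "q < 1"
  shows "1 \<le> propagation_const q n"
proof (induction n)
  case (Suc n)
  have "1 * 1 \<le> 2 / q * propagation_const q n"
    using assms Suc by (intro mult_mono) auto
  moreover have "0 \<le> 4 / min q (1 - q)" using assms by simp
  ultimately show ?case unfolding propagation_const.simps by linarith
qed simp

lemma propagation_const_mono:
  assumes "0 < q" "q < 1"
  shows "mono (propagation_const q)"
proof (rule mono_iff_le_Suc[THEN iffD2], rule allI)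
  fix n
  have "1 * propagation_const q n \<le> 2 / q * propagation_const q n"
    using assms propagation_const_ge_1[OF assms, of n] by (intro mult_right_mono) auto
  moreover have "0 \<le> 4 / min q (1 - q)" using assms by simp
  ultimately show "propagation_const q n \<le> propagation_const q (Suc n)" unfolding propagation_const.simps by linarith
qed

text \<open>Double counting: a site \<open>y\<close> lies in the windows of at most
  \<open>l + 1\<close> starting points.\<close>

lemma sum_window_le:
  fixes g :: "int \<Rightarrow> real"
  assumes "\<And>y. 0 \<le> g y"
  shows "(\<Sum>x\<in>{a..b}. \<Sum>y\<in>{x..min b (x + int l)}. g y) \<le> real (l + 1) * (\<Sum>y\<in>{a..b}. g y)"
proof -
  have "(\<Sum>x\<in>{a..b}. \<Sum>y\<in>{x..min b (x + int l)}. g y)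
      = (\<Sum>x\<in>{a..b}. \<Sum>y\<in>{a..b}. if x \<in> {y - int l..y} then g y else 0)"
  proof (rule sum.cong[OF refl])
    fix x assume "x \<in> {a..b}"
    then have "{x..min b (x + int l)} = {y \<in> {a..b}. x \<in> {y - int l..y}}" by auto
    then show "sum g {x..min b (x + int l)} = (\<Sum>y\<in>{a..b}. if x \<in> {y - int l..y} then g y else 0)"
      by (simp only: sum.inter_filter[OF finite_atLeastAtMost_int])
  qed
  also have "\<dots> = (\<Sum>y\<in>{a..b}. \<Sum>x\<in>{a..b}. if x \<in> {y - int l..y} then g y else 0)"
    by (rule sum.swap)
  also have "\<dots> = (\<Sum>y\<in>{a..b}. real (card ({a..b} \<inter> {y - int l..y})) * g y)"
    by (intro sum.cong refl) (simp only: sum.inter_restrict[OF finite_atLeastAtMost_int, symmetric] sum_constant)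
  also have "\<dots> \<le> (\<Sum>y\<in>{a..b}. real (l + 1) * g y)"
  proof (intro sum_mono mult_right_mono assms)
    fix y
    have "card ({a..b} \<inter> {y - int l..y}) \<le> card {y - int l..y}"
      by (intro card_mono) auto
    also have "\<dots> = l + 1" by simp
    finally show "real (card ({a..b} \<inter> {y - int l..y})) \<le> real (l + 1)"
      by (simp only: of_nat_le_iff)
  qed
  finally show ?thesis by (simp only: sum_distrib_left)
qed

lemma site_diff_foldr:
  "x \<notin> set xs \<Longrightarrow> site_diff x (foldr (site_mean q) xs F) = foldr (site_mean q) xs (site_diff x F)"
  by (induction xs) (auto simp: site_diff_site_mean)

lemma site_mean_commute: "site_mean q x (site_mean q y F) = site_mean q y (site_mean q x F)"
  by (cases "x = y") (auto simp: site_mean_def fun_eq_iff fun_upd_twist algebra_simps)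

lemma site_mean_foldr:
  "site_mean q x (foldr (site_mean q) xs F) = foldr (site_mean q) xs (site_mean q x F)"
  by (induction xs) (auto simp: site_mean_commute[of q x])

lemma foldr_site_mean_cong:
  "(\<And>x. x \<notin> set xs \<Longrightarrow> \<sigma> x = \<tau> x) \<Longrightarrow> foldr (site_mean q) xs F \<sigma> = foldr (site_mean q) xs F \<tau>"
proof (induction xs arbitrary: \<sigma> \<tau>)
  case Nil
  then have "\<sigma> = \<tau>" by auto
  then show ?case by simp
next
  case (Cons y xs)
  have "foldr (site_mean q) xs F (\<sigma>(y := v)) = foldr (site_mean q) xs F (\<tau>(y := v))" for v
    using Cons.prems by (intro Cons.IH) auto
  then show ?case by (simp add: site_mean_def[of q y])
qed

section \<open>Local forms and the propagation of a zero\<close>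

context east_interval
begin

lemma E_weighted_site_mean:
  assumes "y \<in> {a..b}" "\<And>\<sigma> v. w (\<sigma>(y := v)) = w \<sigma>"
  shows "E (\<lambda>\<sigma>. w \<sigma> * site_mean q y F \<sigma>) = E (\<lambda>\<sigma>. w \<sigma> * F \<sigma>)"
proof -
  have "E (\<lambda>\<sigma>. w \<sigma> * F \<sigma>) = E (site_mean q y (\<lambda>\<sigma>. w \<sigma> * F \<sigma>))"
    using E_site_mean[OF assms(1)] by simp
  also have "\<dots> = E (\<lambda>\<sigma>. w \<sigma> * site_mean q y F \<sigma>)"
    by (simp add: site_mean_def[abs_def] assms(2) algebra_simps)
  finally show ?thesis by simp
qed

lemma site_mean_square_le: "(site_mean q y F \<sigma>)\<^sup>2 \<le> site_mean q y (\<lambda>\<sigma>. (F \<sigma>)\<^sup>2) \<sigma>"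
  using q_pos q_less_1 by (simp add: site_mean_square)

text \<open>Jensen's inequality one site at a time; the weight passes through because it does not
  depend on the averaged sites.\<close>

lemma E_weighted_foldr_square_le:
  assumes "set xs \<subseteq> {a..b}" "\<And>\<sigma> y v. y \<in> set xs \<Longrightarrow> w (\<sigma>(y := v)) = w \<sigma>" "\<And>\<sigma>. 0 \<le> w \<sigma>"
  shows "E (\<lambda>\<sigma>. w \<sigma> * (foldr (site_mean q) xs F \<sigma>)\<^sup>2) \<le> E (\<lambda>\<sigma>. w \<sigma> * (F \<sigma>)\<^sup>2)"
  using assms(1,2)
proof (induction xs)
  case (Cons y xs)
  let ?G = "foldr (site_mean q) xs F"
  have wy: "w (\<sigma>(y := v)) = w \<sigma>" for \<sigma> v by (rule Cons.prems(2)) simp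
  have "E (\<lambda>\<sigma>. w \<sigma> * (foldr (site_mean q) (y # xs) F \<sigma>)\<^sup>2)
      \<le> E (\<lambda>\<sigma>. w \<sigma> * site_mean q y (\<lambda>\<sigma>. (?G \<sigma>)\<^sup>2) \<sigma>)"
    by (intro E_mono mult_left_mono assms(3)) (simp add: site_mean_square_le)
  also have "\<dots> = E (\<lambda>\<sigma>. w \<sigma> * (?G \<sigma>)\<^sup>2)"
    using Cons.prems(1) wy by (intro E_weighted_site_mean) simp_all
  also have "\<dots> \<le> E (\<lambda>\<sigma>. w \<sigma> * (F \<sigma>)\<^sup>2)"
    using Cons by auto
  finally show ?case .
qed simp

text \<open>Contribution of \<open>x\<close> to \<open>east_dirichlet q a b F F\<close>, up to the
  factor \<open>q * (1 - q)\<close>.\<close>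

definition local_form :: "((int \<Rightarrow> bool) \<Rightarrow> real) \<Rightarrow> int \<Rightarrow> real" where
  "local_form F x = E (\<lambda>\<sigma>. constr x \<sigma> * (site_diff x F \<sigma>)\<^sup>2)"

lemma local_form_nonneg: "0 \<le> local_form F x"
  unfolding local_form_def by (intro E_nonneg) (simp add: constr_nonneg)

text \<open>
  A zero at \<open>z + 1\<close> allows a free flip at \<open>z\<close>.  Comparing the configuration with a one at \<open>z\<close> with
  the one where \<open>z\<close> has been flipped, the zero moves one step to the left at the price of the
  local form at \<open>z\<close>.
\<close>

lemma propagate_zero:
  assumes "a \<le> x" "x + int n \<le> b"
  shows "E (\<lambda>\<sigma>. constr (x + int n) \<sigma> * (site_diff x F \<sigma>)\<^sup>2)
    \<le> propagation_const q n * (\<Sum>y\<in>{x..x + int n}. local_form F y)"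
  using assms(2)
proof (induction n)
  case 0
  then show ?case by (simp add: local_form_def)
next
  case (Suc n)
  define z where "z = x + int (Suc n)"
  define m where "m = min q (1 - q)"
  have m: "0 < m" "m \<le> q" "m \<le> 1 - q" using q_pos q_less_1 by (auto simp: m_def)
  have z: "z \<in> {a..b}" "x \<in> {a..b}" "x \<noteq> z" "x \<noteq> z + 1" "z - 1 = x + int n" using Suc.prems assms(1) by (auto simp: z_def)
  let ?G = "\<lambda>\<sigma>. (site_diff x F \<sigma>)\<^sup>2" and ?g = "site_diff z F"
  have pointwise: "site_mean q z (\<lambda>\<sigma>. constr z \<sigma> * ?G \<sigma>) \<sigma>
      \<le> 2 / q * site_mean q z (\<lambda>\<sigma>. constr (z - 1) \<sigma> * ?G \<sigma>) \<sigma>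
        + 4 / m * site_mean q x (\<lambda>\<sigma>. constr z \<sigma> * (?g \<sigma>)\<^sup>2) \<sigma>" for \<sigma>
  proof -
    define k where "k = constr z \<sigma>"
    define u1 u0 where "u1 = site_diff x F (\<sigma>(z := True))" and "u0 = site_diff x F (\<sigma>(z := False))"
    define g1 g0 where "g1 = ?g (\<sigma>(x := True))" and "g0 = ?g (\<sigma>(x := False))"
    have k: "0 \<le> k" "k \<le> 1" by (auto simp: k_def constr_nonneg constr_le_1)
    \<comment> \<open>The mixed difference in \<open>x\<close> and \<open>z\<close> is symmetric:
      the change of the \<open>x\<close>-gradient under a flip at \<open>z\<close> is the change of
      the \<open>z\<close>-gradient under a flip at \<open>x\<close>.\<close>
    have eq: "u1 = u0 + (g1 - g0)"
      using z(3) by (simp add: u1_def u0_def g1_def g0_def site_diff_def fun_upd_twist)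
    have "u1\<^sup>2 \<le> 2 * u0\<^sup>2 + 2 * (g1 - g0)\<^sup>2"
      using zero_le_power2[of "u0 - (g1 - g0)"] unfolding eq by (simp add: power2_eq_square algebra_simps)
    moreover have "(g1 - g0)\<^sup>2 \<le> 2 * (g1\<^sup>2 + g0\<^sup>2)"
      using zero_le_power2[of "g1 + g0"] by (simp add: power2_eq_square algebra_simps)
    moreover
    define X where "X = ((1 - q) * g1\<^sup>2 + q * g0\<^sup>2) / m"
    have "g1\<^sup>2 + g0\<^sup>2 \<le> X"
    proof -
      have "m * g1\<^sup>2 + m * g0\<^sup>2 \<le> (1 - q) * g1\<^sup>2 + q * g0\<^sup>2"
        using m by (intro add_mono mult_right_mono) auto
      then show ?thesis using m(1) by (simp add: X_def field_simps)
    qed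
    ultimately have u1: "u1\<^sup>2 \<le> 2 * u0\<^sup>2 + 4 * X" by simp
    define w where "w = 4 / m * ((1 - q) * g1\<^sup>2 + q * g0\<^sup>2)"
    have wX: "w = 4 * X" by (simp add: w_def X_def)
    have w: "0 \<le> w" unfolding w_def using m q_pos q_less_1 by (intro mult_nonneg_nonneg add_nonneg_nonneg) auto
    have "(1 - q) * u1\<^sup>2 + q * u0\<^sup>2 \<le> (1 - q) * (2 * u0\<^sup>2 + w) + q * (2 * u0\<^sup>2 + w)"
      using u1 w q_pos q_less_1 unfolding wX[symmetric]
      by (intro add_mono mult_left_mono) auto
    also have "\<dots> = 2 * u0\<^sup>2 + w" by (simp add: algebra_simps)
    finally have "k * ((1 - q) * u1\<^sup>2 + q * u0\<^sup>2) \<le> k * (2 * u0\<^sup>2) + k * w"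
      using k by (metis distrib_left mult_left_mono)
    also have "k * (2 * u0\<^sup>2) \<le> 2 * u0\<^sup>2" using k by (intro mult_left_le_one_le) auto
    finally have "k * ((1 - q) * u1\<^sup>2 + q * u0\<^sup>2) \<le> 2 * u0\<^sup>2 + k * w" by simp
    moreover have "site_mean q z (\<lambda>\<sigma>. constr z \<sigma> * ?G \<sigma>) \<sigma> = k * ((1 - q) * u1\<^sup>2 + q * u0\<^sup>2)"
      by (simp add: site_mean_def k_def u1_def u0_def constr_upd algebra_simps)
    \<comment> \<open>\<open>constr (z - 1)\<close> vanishes unless \<open>z\<close> carries a zero,
      so only \<open>u0\<close> survives, with weight \<open>q\<close>. This is the source of
      \<open>1 / q\<close>.\<close>
    moreover have "site_mean q z (\<lambda>\<sigma>. constr (z - 1) \<sigma> * ?G \<sigma>) \<sigma> = q * u0\<^sup>2"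
      using z(1) by (simp add: site_mean_def u1_def u0_def east_constraint_def)
    moreover have "site_mean q x (\<lambda>\<sigma>. constr z \<sigma> * (?g \<sigma>)\<^sup>2) \<sigma> = k * ((1 - q) * g1\<^sup>2 + q * g0\<^sup>2)"
      using z(4) by (simp add: site_mean_def k_def g1_def g0_def constr_upd algebra_simps)
    ultimately show ?thesis using q_pos by (simp add: w_def mult_ac)
  qed
  have "E (\<lambda>\<sigma>. constr z \<sigma> * ?G \<sigma>) = E (site_mean q z (\<lambda>\<sigma>. constr z \<sigma> * ?G \<sigma>))"
    using E_site_mean[OF z(1)] by simp
  also have "\<dots> \<le> E (\<lambda>\<sigma>. 2 / q * site_mean q z (\<lambda>\<sigma>. constr (z - 1) \<sigma> * ?G \<sigma>) \<sigma>
        + 4 / m * site_mean q x (\<lambda>\<sigma>. constr z \<sigma> * (?g \<sigma>)\<^sup>2) \<sigma>)"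
    by (intro E_mono pointwise)
  also have "\<dots> = 2 / q * E (\<lambda>\<sigma>. constr (x + int n) \<sigma> * ?G \<sigma>) + 4 / m * local_form F z"
    by (simp only: E_add E_cmult E_site_mean[OF z(1)] E_site_mean[OF z(2)] z(5) local_form_def)
  also have "\<dots> \<le> 2 / q * (propagation_const q n * (\<Sum>y\<in>{x..x + int n}. local_form F y)) + 4 / m * local_form F z"
    using q_pos Suc by (intro add_right_mono mult_left_mono) auto
  also have "\<dots> \<le> propagation_const q (Suc n) * (\<Sum>y\<in>{x..x + int n}. local_form F y) + propagation_const q (Suc n) * local_form F z"
  proof (intro add_mono)
    show "2 / q * (propagation_const q n * (\<Sum>y\<in>{x..x + int n}. local_form F y)) \<le> propagation_const q (Suc n) * (\<Sum>y\<in>{x..x + int n}. local_form F y)"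
    proof -
      have "0 \<le> 4 / m * (\<Sum>y\<in>{x..x + int n}. local_form F y)"
        using m(1) by (intro mult_nonneg_nonneg sum_nonneg local_form_nonneg) auto
      then show ?thesis
        unfolding propagation_const.simps m_def[symmetric] distrib_right by (simp only: mult.assoc le_add_same_cancel1)
    qed
    show "4 / m * local_form F z \<le> propagation_const q (Suc n) * local_form F z"
      using q_pos q_less_1 propagation_const_ge_1[of q n]
      by (intro mult_right_mono local_form_nonneg) (simp add: m_def[symmetric])
  qed
  also have "\<dots> = propagation_const q (Suc n) * (\<Sum>y\<in>{x..z}. local_form F y)"
  proof -
    have "{x..z} = insert z {x..x + int n}" by (auto simp: z_def)
    moreover have "z \<notin> {x..x + int n}" by (auto simp: z_def)
    ultimately show ?thesis by (simp add: algebra_simps)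
  qed
  finally show ?case unfolding z_def .
qed

section \<open>Martingale decomposition of the variance\<close>

definition tail_mean :: "((int \<Rightarrow> bool) \<Rightarrow> real) \<Rightarrow> int \<Rightarrow> (int \<Rightarrow> bool) \<Rightarrow> real" where
  "tail_mean F x = foldr (site_mean q) [x..b] F"

lemma tail_mean_rec: "x \<le> b \<Longrightarrow> tail_mean F x = site_mean q x (tail_mean F (x + 1))"
  by (simp add: tail_mean_def upto_rec1)

lemma tail_mean_beyond: "b < x \<Longrightarrow> tail_mean F x = F"
  by (simp add: tail_mean_def)

lemma tail_mean_split:
  assumes "x \<le> z" "z \<le> b + 1"
  shows "tail_mean F x = foldr (site_mean q) [x..z - 1] (tail_mean F z)"
proof -
  have "[x..b] = [x..z - 1] @ [z..b]"
  proof (cases "z \<le> b")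
    case False
    then have "z = b + 1" using assms by simp
    then show ?thesis by simp
  qed (use upto_split1[of x z b] assms in auto)
  then show ?thesis by (simp add: tail_mean_def)
qed

lemma E_tail_mean: "a \<le> x \<Longrightarrow> E (tail_mean F x) = E F"
proof -
  have "E (foldr (site_mean q) xs F) = E F" if "set xs \<subseteq> {a..b}" for xs
    using that by (induction xs) (auto simp: E_site_mean)
  then show "a \<le> x \<Longrightarrow> ?thesis" by (simp add: tail_mean_def)
qed

text \<open>With the whole interval averaged no dependence on the configuration is left, since
  elements of \<open>configs a b\<close> agree outside it.\<close>

lemma tail_mean_first: "\<sigma> \<in> configs a b \<Longrightarrow> tail_mean F a \<sigma> = E F"
proof -
  assume \<sigma>: "\<sigma> \<in> configs a b"
  have "E F = E (tail_mean F a)" by (simp add: E_tail_mean)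
  also have "\<dots> = E (\<lambda>_. tail_mean F a \<sigma>)"
    unfolding tail_mean_def using \<sigma>
    by (intro E_cong foldr_site_mean_cong) (auto simp: configs_outside)
  finally show ?thesis by simp
qed

lemma site_diff_tail_mean:
  "x < y \<Longrightarrow> site_diff x (tail_mean F y) = tail_mean (site_diff x F) y"
  by (simp add: tail_mean_def site_diff_foldr)

text \<open>
  \<open>tail_mean F x\<close> is the conditional expectation of \<open>F\<close> given the sites to the left of \<open>x\<close>, so up to
  the factor \<open>q (1 - q)\<close> the quantity below is the second moment of a martingale increment.
\<close>

definition increment :: "((int \<Rightarrow> bool) \<Rightarrow> real) \<Rightarrow> int \<Rightarrow> real" where
  "increment F x = E (\<lambda>\<sigma>. (site_diff x (tail_mean F (x + 1)) \<sigma>)\<^sup>2)"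

lemma increment_nonneg: "0 \<le> increment F x"
  unfolding increment_def by (intro E_nonneg) simp

lemma E_square_site_mean:
  "x \<in> {a..b} \<Longrightarrow> E (\<lambda>\<sigma>. (F \<sigma>)\<^sup>2) = E (\<lambda>\<sigma>. (site_mean q x F \<sigma>)\<^sup>2) + q * (1 - q) * E (\<lambda>\<sigma>. (site_diff x F \<sigma>)\<^sup>2)"
  using E_site_mean[of x "\<lambda>\<sigma>. (F \<sigma>)\<^sup>2"]
  unfolding site_mean_square[abs_def] E_add E_cmult by simp

text \<open>Telescoping: by \<open>E_square_site_mean\<close>, averaging over one further site
  lowers the second moment by exactly \<open>q * (1 - q)\<close> times the increment there.\<close>

lemma sum_increment:
  assumes "a \<le> x" "x \<le> z" "z \<le> b + 1"
  shows "q * (1 - q) * (\<Sum>y\<in>{x..z - 1}. increment F y)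
    = E (\<lambda>\<sigma>. (tail_mean F z \<sigma>)\<^sup>2) - E (\<lambda>\<sigma>. (tail_mean F x \<sigma>)\<^sup>2)"
  using assms(2,3)
proof (induction z rule: int_ge_induct)
  case (step z)
  then have z: "z \<in> {a..b}" using assms(1) by auto
  have "{x..z + 1 - 1} = insert z {x..z - 1}" "z \<notin> {x..z - 1}" using step by auto
  then have "q * (1 - q) * (\<Sum>y\<in>{x..z + 1 - 1}. increment F y)
      = q * (1 - q) * increment F z + q * (1 - q) * (\<Sum>y\<in>{x..z - 1}. increment F y)"
    by (simp add: distrib_left)
  also have "\<dots> = q * (1 - q) * increment F z + (E (\<lambda>\<sigma>. (tail_mean F z \<sigma>)\<^sup>2) - E (\<lambda>\<sigma>. (tail_mean F x \<sigma>)\<^sup>2))"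
    using step by simp
  also have "E (\<lambda>\<sigma>. (tail_mean F z \<sigma>)\<^sup>2) = E (\<lambda>\<sigma>. (tail_mean F (z + 1) \<sigma>)\<^sup>2) - q * (1 - q) * increment F z"
    using E_square_site_mean[OF z, of "tail_mean F (z + 1)"] z by (simp add: tail_mean_rec increment_def)
  finally show ?case by simp
qed simp

text \<open>The telescoping sum runs from \<open>tail_mean F a\<close>, the constant mean, to
  \<open>tail_mean F (b + 1)\<close>, which is \<open>F\<close> itself.\<close>

lemma variance_eq: "E (\<lambda>\<sigma>. (F \<sigma> - E F)\<^sup>2) = q * (1 - q) * (\<Sum>y\<in>{a..b}. increment F y)"
proof -
  have "E (\<lambda>\<sigma>. (F \<sigma> - E F)\<^sup>2) = E (\<lambda>\<sigma>. (F \<sigma>)\<^sup>2 - (2 * E F) * F \<sigma> + (E F)\<^sup>2)"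
    by (intro E_cong) (simp add: power2_eq_square algebra_simps)
  also have "\<dots> = E (\<lambda>\<sigma>. (F \<sigma>)\<^sup>2) - (E F)\<^sup>2"
    by (simp only: E_add E_diff E_cmult E_const) (simp add: power2_eq_square)
  also have "E (\<lambda>\<sigma>. (F \<sigma>)\<^sup>2) = E (\<lambda>\<sigma>. (tail_mean F (b + 1) \<sigma>)\<^sup>2)"
    by (simp add: tail_mean_beyond)
  also have "(E F)\<^sup>2 = E (\<lambda>\<sigma>. (tail_mean F a \<sigma>)\<^sup>2)"
  proof -
    have "E (\<lambda>\<sigma>. (tail_mean F a \<sigma>)\<^sup>2) = E (\<lambda>\<sigma>. (E F)\<^sup>2)"
      by (intro E_cong) (simp add: tail_mean_first)
    then show ?thesis by simp
  qed
  finally show ?thesis using sum_increment[of a "b + 1" F] a_le_b by simp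
qed

text \<open>Up to the factor \<open>q * (1 - q)\<close>, the left side is the second moment lost
  when \<open>tail_mean F z\<close> is averaged over \<open>x\<close> alone, the right side that
  lost by averaging over all of \<open>{x..z - 1}\<close>. Site averages commute, so
  \<open>x\<close> may go first, and by Jensen the later averages only lose more.\<close>

lemma site_diff_tail_mean_le:
  assumes "x \<in> {a..b}" "x < z" "z \<le> b + 1"
  shows "E (\<lambda>\<sigma>. (site_diff x (tail_mean F z) \<sigma>)\<^sup>2) \<le> (\<Sum>y\<in>{x..z - 1}. increment F y)"
proof -
  define u where "u = tail_mean F z"
  have "tail_mean F x = site_mean q x (tail_mean F (x + 1))"
    using assms by (intro tail_mean_rec) auto
  also have "tail_mean F (x + 1) = foldr (site_mean q) [x + 1..z - 1] u"
    unfolding u_def using assms by (intro tail_mean_split) auto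
  finally have "tail_mean F x = foldr (site_mean q) [x + 1..z - 1] (site_mean q x u)"
    by (simp add: site_mean_foldr)
  then have "E (\<lambda>\<sigma>. (tail_mean F x \<sigma>)\<^sup>2) \<le> E (\<lambda>\<sigma>. (site_mean q x u \<sigma>)\<^sup>2)"
    using E_weighted_foldr_square_le[of "[x + 1..z - 1]" "\<lambda>_. 1" "site_mean q x u"] assms by auto
  also have "E (\<lambda>\<sigma>. (site_mean q x u \<sigma>)\<^sup>2) = E (\<lambda>\<sigma>. (u \<sigma>)\<^sup>2) - q * (1 - q) * E (\<lambda>\<sigma>. (site_diff x u \<sigma>)\<^sup>2)"
    using E_square_site_mean[OF assms(1), of u] by simp
  finally have "q * (1 - q) * E (\<lambda>\<sigma>. (site_diff x u \<sigma>)\<^sup>2) \<le> q * (1 - q) * (\<Sum>y\<in>{x..z - 1}. increment F y)"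
    using sum_increment[of x z F] assms by (simp add: u_def)
  then show ?thesis unfolding u_def using q_pos q_less_1 by simp
qed

text \<open>
  Averaging over the site \<open>x + 1 + n\<close>, the contribution of a zero there is controlled by
  \<open>propagate_zero\<close>, whereas that of a one contracts by a factor \<open>1 - q / 2\<close>.
\<close>

lemma tail_step:
  assumes "x \<in> {a..b}"
  shows "E (\<lambda>\<sigma>. (site_diff x (tail_mean F (x + 1 + int n)) \<sigma>)\<^sup>2)
    \<le> 2 / q * propagation_const q n * (\<Sum>y\<in>{x..min b (x + int n)}. local_form F y)
      + (1 - q / 2) * E (\<lambda>\<sigma>. (site_diff x (tail_mean F (x + 1 + int (Suc n))) \<sigma>)\<^sup>2)"
proof (cases "x + 1 + int n \<le> b")
  case True
  define y where "y = x + 1 + int n"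
  have y: "y \<in> {a..b}" "y - 1 = x + int n" "x < y" using assms True by (auto simp: y_def)
  define u where "u = site_diff x (tail_mean F (y + 1))"
  have eq: "site_diff x (tail_mean F y) = site_mean q y u"
    using y by (simp add: tail_mean_rec site_diff_site_mean u_def)
  have pointwise: "(site_mean q y u \<sigma>)\<^sup>2 \<le> 2 / q * site_mean q y (\<lambda>\<sigma>. constr (y - 1) \<sigma> * (u \<sigma>)\<^sup>2) \<sigma>
      + (1 - q / 2) * site_mean q y (\<lambda>\<sigma>. (u \<sigma>)\<^sup>2) \<sigma>" for \<sigma>
  proof -
    define u1 u0 where "u1 = u (\<sigma>(y := True))" and "u0 = u (\<sigma>(y := False))"
    \<comment> \<open>Completing the square in \<open>u1\<close>: the slack between the factor
      \<open>1 - q / 2\<close> and the factor \<open>1 - q\<close> absorbs the cross term.\<close>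
    have "0 \<le> q * (1 - q) / 2 * (u1 - 2 * u0)\<^sup>2 + ((2 - q) + q\<^sup>2 / 2) * u0\<^sup>2"
      using q_pos q_less_1 by (intro add_nonneg_nonneg mult_nonneg_nonneg) auto
    also have "\<dots> = 2 * u0\<^sup>2 + (1 - q / 2) * ((1 - q) * u1\<^sup>2 + q * u0\<^sup>2) - ((1 - q) * u1 + q * u0)\<^sup>2"
      by (simp add: power2_eq_square field_simps)
    finally have "((1 - q) * u1 + q * u0)\<^sup>2 \<le> 2 * u0\<^sup>2 + (1 - q / 2) * ((1 - q) * u1\<^sup>2 + q * u0\<^sup>2)"
      by simp
    moreover have "site_mean q y (\<lambda>\<sigma>. constr (y - 1) \<sigma> * (u \<sigma>)\<^sup>2) \<sigma> = q * u0\<^sup>2"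
      using y by (simp add: site_mean_def u0_def east_constraint_def)
    ultimately show ?thesis
      using q_pos by (simp add: site_mean_def u1_def u0_def)
  qed
  \<comment> \<open>The averages in \<open>u\<close> concern sites beyond \<open>y\<close>, while
    the weight only looks at \<open>y\<close>, so Jensen removes them.\<close>
  have "E (\<lambda>\<sigma>. constr (y - 1) \<sigma> * (u \<sigma>)\<^sup>2) \<le> E (\<lambda>\<sigma>. constr (y - 1) \<sigma> * (site_diff x F \<sigma>)\<^sup>2)"
  proof -
    have "u = foldr (site_mean q) [y + 1..b] (site_diff x F)"
      using y(3) by (simp add: u_def site_diff_tail_mean, simp add: tail_mean_def)
    then show ?thesis
      using y by (simp only:) (intro E_weighted_foldr_square_le, auto simp: constr_upd constr_nonneg)
  qed
  also have "\<dots> \<le> propagation_const q n * (\<Sum>y\<in>{x..x + int n}. local_form F y)"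
    unfolding y(2) using assms True by (intro propagate_zero) auto
  finally have le: "E (\<lambda>\<sigma>. constr (y - 1) \<sigma> * (u \<sigma>)\<^sup>2) \<le> propagation_const q n * (\<Sum>y\<in>{x..x + int n}. local_form F y)" .
  have "E (\<lambda>\<sigma>. (site_diff x (tail_mean F y) \<sigma>)\<^sup>2)
      \<le> E (\<lambda>\<sigma>. 2 / q * site_mean q y (\<lambda>\<sigma>. constr (y - 1) \<sigma> * (u \<sigma>)\<^sup>2) \<sigma>
      + (1 - q / 2) * site_mean q y (\<lambda>\<sigma>. (u \<sigma>)\<^sup>2) \<sigma>)"
    unfolding eq by (intro E_mono pointwise)
  also have "\<dots> = 2 / q * E (\<lambda>\<sigma>. constr (y - 1) \<sigma> * (u \<sigma>)\<^sup>2) + (1 - q / 2) * E (\<lambda>\<sigma>. (u \<sigma>)\<^sup>2)"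
    by (simp only: E_add E_cmult E_site_mean[OF y(1)])
  also have "\<dots> \<le> 2 / q * (propagation_const q n * (\<Sum>y\<in>{x..x + int n}. local_form F y)) + (1 - q / 2) * E (\<lambda>\<sigma>. (u \<sigma>)\<^sup>2)"
    using q_pos by (intro add_right_mono mult_left_mono le) auto
  finally show ?thesis using True by (simp add: y_def u_def mult.assoc add_ac)
next
  case False
  define k where "k = nat (b - x)"
  have k: "x + int k = b" "k \<le> n" using assms False by (auto simp: k_def)
  have "E (\<lambda>\<sigma>. (site_diff x (tail_mean F (x + 1 + int n)) \<sigma>)\<^sup>2) = E (\<lambda>\<sigma>. constr (x + int k) \<sigma> * (site_diff x F \<sigma>)\<^sup>2)"
    using False k by (simp add: tail_mean_beyond east_constraint_def)
  also have "\<dots> \<le> propagation_const q k * (\<Sum>y\<in>{x..x + int k}. local_form F y)"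
    using assms k by (intro propagate_zero) auto
  also have "\<dots> \<le> (2 / q * propagation_const q n) * (\<Sum>y\<in>{x..x + int k}. local_form F y)"
  proof (intro mult_right_mono sum_nonneg local_form_nonneg)
    have "1 * propagation_const q k \<le> 2 / q * propagation_const q n"
      using q_pos q_less_1 propagation_const_ge_1[of q k] monoD[OF propagation_const_mono k(2), of q]
      by (intro mult_mono) auto
    then show "propagation_const q k \<le> 2 / q * propagation_const q n" by simp
  qed
  also have "\<dots> \<le> 2 / q * propagation_const q n * (\<Sum>y\<in>{x..x + int k}. local_form F y)
      + (1 - q / 2) * E (\<lambda>\<sigma>. (site_diff x (tail_mean F (x + 1 + int (Suc n))) \<sigma>)\<^sup>2)"
    using q_pos q_less_1 by (simp add: E_nonneg)
  also have "x + int k = min b (x + int n)" using k by auto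
  finally show ?thesis .
qed

text \<open>\<open>tail_step\<close> iterated \<open>l\<close> times. The powers of
  \<open>1 - q / 2\<close> in front of the local forms are bounded by 1, whence the factor
  \<open>l\<close>; the last gradient is controlled by
  \<open>site_diff_tail_mean_le\<close>.\<close>

lemma increment_le:
  assumes "x \<in> {a..b}"
  shows "increment F x \<le> 2 / q * real l * propagation_const q l * (\<Sum>y\<in>{x..min b (x + int l)}. local_form F y)
      + (1 - q / 2) ^ l * (\<Sum>y\<in>{x..min b (x + int l)}. increment F y)"
proof -
  define A where "A = 2 / q * propagation_const q l * (\<Sum>y\<in>{x..min b (x + int l)}. local_form F y)"
  define \<beta> where "\<beta> n = E (\<lambda>\<sigma>. (site_diff x (tail_mean F (x + 1 + int n)) \<sigma>)\<^sup>2)" for n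
  have A: "0 \<le> A"
    using q_pos q_less_1 propagation_const_ge_1[of q l]
    unfolding A_def by (intro mult_nonneg_nonneg sum_nonneg local_form_nonneg) auto
  have step: "\<beta> n \<le> A + (1 - q / 2) * \<beta> (Suc n)" if "n < l" for n
  proof -
    have "2 / q * propagation_const q n * (\<Sum>y\<in>{x..min b (x + int n)}. local_form F y) \<le> A"
      unfolding A_def
    proof (intro mult_mono sum_mono2)
      show "propagation_const q n \<le> propagation_const q l"
        using monoD[OF propagation_const_mono[OF q_pos q_less_1], of n l] that by simp
    qed (use q_pos q_less_1 that propagation_const_ge_1[of q n] propagation_const_ge_1[of q l] in
        \<open>auto simp: local_form_nonneg intro!: sum_nonneg mult_nonneg_nonneg\<close>)
    then show ?thesis using tail_step[OF assms, of F n] unfolding \<beta>_def by linarith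
  qed
  have "\<beta> 0 \<le> real n * A + (1 - q / 2) ^ n * \<beta> n" if "n \<le> l" for n
    using that
  proof (induction n)
    case (Suc n)
    have "\<beta> 0 \<le> real n * A + (1 - q / 2) ^ n * \<beta> n" using Suc by simp
    also have "\<dots> \<le> real n * A + (1 - q / 2) ^ n * (A + (1 - q / 2) * \<beta> (Suc n))"
      using q_pos q_less_1 Suc.prems by (intro add_left_mono mult_left_mono step) auto
    also have "(1 - q / 2) ^ n * (A + (1 - q / 2) * \<beta> (Suc n)) = (1 - q / 2) ^ n * A + (1 - q / 2) ^ Suc n * \<beta> (Suc n)"
      by (simp add: algebra_simps)
    also have "(1 - q / 2) ^ n * A \<le> 1 * A"
      using q_pos q_less_1 A by (intro mult_right_mono power_le_one) auto
    finally show ?case by (simp add: algebra_simps)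
  qed simp
  from this[of l] have "\<beta> 0 \<le> real l * A + (1 - q / 2) ^ l * \<beta> l" by simp
  also have "\<beta> l \<le> (\<Sum>y\<in>{x..min b (x + int l)}. increment F y)"
  proof (cases "x + int l \<le> b")
    case True
    then show ?thesis using site_diff_tail_mean_le[OF assms, of "x + 1 + int l" F] by (simp add: \<beta>_def)
  next
    case False
    then have "tail_mean F (x + 1 + int l) = tail_mean F (b + 1)" by (simp add: tail_mean_beyond)
    then show ?thesis using False site_diff_tail_mean_le[OF assms, of "b + 1" F] assms by (simp add: \<beta>_def)
  qed
  finally show ?thesis
    using q_pos q_less_1 by (simp add: \<beta>_def A_def increment_def mult_ac)
qed

text \<open>Summing \<open>increment_le\<close> over \<open>x\<close> bounds the total
  \<open>B\<close> of the increments by local forms plus at most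
  \<open>(real l + 1) * (1 - q / 2) ^ l\<close> times \<open>B\<close> itself. The hypothesis allows
  absorbing the latter at the cost of a factor 2.\<close>

lemma poincare:
  assumes "(real l + 1) * (1 - q / 2) ^ l \<le> 1 / 2"
  shows "E (\<lambda>\<sigma>. (F \<sigma> - E F)\<^sup>2)
    \<le> 4 / q * real l * (real l + 1) * propagation_const q l * east_dirichlet q a b F F"
proof -
  define A where "A = 2 / q * real l * propagation_const q l"
  define r where "r = (1 - q / 2) ^ l"
  define B D where "B = (\<Sum>x\<in>{a..b}. increment F x)" and "D = (\<Sum>x\<in>{a..b}. local_form F x)"
  have A: "0 \<le> A" using q_pos q_less_1 propagation_const_ge_1[of q l] by (auto simp: A_def)
  have r: "0 \<le> r" using q_pos q_less_1 by (auto simp: r_def)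
  have B: "0 \<le> B" unfolding B_def by (intro sum_nonneg increment_nonneg)
  have "B \<le> (\<Sum>x\<in>{a..b}. A * (\<Sum>y\<in>{x..min b (x + int l)}. local_form F y)
      + r * (\<Sum>y\<in>{x..min b (x + int l)}. increment F y))"
    unfolding B_def A_def r_def by (intro sum_mono increment_le)
  also have "\<dots> = A * (\<Sum>x\<in>{a..b}. \<Sum>y\<in>{x..min b (x + int l)}. local_form F y)
      + r * (\<Sum>x\<in>{a..b}. \<Sum>y\<in>{x..min b (x + int l)}. increment F y)"
    by (simp only: sum.distrib sum_distrib_left)
  also have "\<dots> \<le> A * (real (l + 1) * D) + r * (real (l + 1) * B)"
    unfolding B_def D_def
    by (intro add_mono mult_left_mono sum_window_le A r local_form_nonneg increment_nonneg)
  also have "r * (real (l + 1) * B) = ((real l + 1) * r) * B" by (simp add: algebra_simps)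
  also have "\<dots> \<le> 1 / 2 * B" using assms B unfolding r_def by (intro mult_right_mono) auto
  finally have "B \<le> 2 * A * (real l + 1) * D" by (simp add: algebra_simps)
  then have "q * (1 - q) * B \<le> q * (1 - q) * (2 * A * (real l + 1) * D)"
    using q_pos q_less_1 by (intro mult_left_mono) auto
  also have "\<dots> = 2 * A * (real l + 1) * (q * (1 - q) * D)" by (simp only: mult_ac)
  also have "q * (1 - q) * D = east_dirichlet q a b F F"
    by (simp add: dirichlet_eq D_def local_form_def power2_eq_square)
  finally show ?thesis by (simp add: variance_eq B_def A_def mult_ac)
qed

end

section \<open>Log-Sobolev upper bound\<close>

lemma sinh_mult_le:
  fixes \<rho> y :: real
  assumes "0 \<le> \<rho>" "\<rho> \<le> 1" "0 \<le> y"
  shows "sinh (\<rho> * y) \<le> \<rho> * sinh y"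
proof -
  have "\<rho> * sinh 0 - sinh (\<rho> * 0) \<le> \<rho> * sinh y - sinh (\<rho> * y)"
  proof (rule DERIV_nonneg_imp_nondecreasing[OF assms(3)])
    fix z :: real assume "0 \<le> z" "z \<le> y"
    have "((\<lambda>z. \<rho> * sinh z - sinh (\<rho> * z)) has_real_derivative \<rho> * (cosh z - cosh (\<rho> * z))) (at z)"
      by (auto intro!: derivative_eq_intros simp: algebra_simps)
    moreover have "cosh (\<rho> * z) \<le> cosh z"
      using assms \<open>0 \<le> z\<close> by (intro cosh_real_nonneg_le_iff[THEN iffD2]) (auto simp: mult_left_le_one_le)
    ultimately show "\<exists>d. ((\<lambda>z. \<rho> * sinh z - sinh (\<rho> * z)) has_real_derivative d) (at z) \<and> 0 \<le> d"
      using assms by (intro exI[of _ "\<rho> * (cosh z - cosh (\<rho> * z))"]) auto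
  qed
  then show ?thesis by simp
qed

lemma sinh_le_mult_cosh:
  fixes y :: real
  assumes "0 \<le> y"
  shows "sinh y \<le> y * cosh y"
proof -
  have "0 * cosh 0 - sinh 0 \<le> y * cosh y - sinh y"
  proof (rule DERIV_nonneg_imp_nondecreasing[OF assms])
    fix z :: real assume "0 \<le> z"
    have "((\<lambda>z. z * cosh z - sinh z) has_real_derivative z * sinh z) (at z)"
      by (auto intro!: derivative_eq_intros)
    then show "\<exists>d. ((\<lambda>z. z * cosh z - sinh z) has_real_derivative d) (at z) \<and> 0 \<le> d"
      using \<open>0 \<le> z\<close> by (intro exI[of _ "z * sinh z"]) auto
  qed
  then show ?thesis by simp
qed

lemma cosh_minus_one: "cosh t - 1 = 2 * (sinh (t / 2))\<^sup>2" for t :: real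
  using cosh_double[of "t / 2"] cosh_square_eq[of "t / 2"] by simp

text \<open>\<open>cosh_minus_one\<close> turns both sides into squares of hyperbolic sines at half
  the argument, where \<open>sinh_mult_le\<close> applies.\<close>

lemma cosh_minus_one_mult_le:
  fixes \<rho> t :: real
  assumes "\<bar>\<rho>\<bar> \<le> 1"
  shows "cosh (\<rho> * t) - 1 \<le> \<rho>\<^sup>2 * (cosh t - 1)"
proof -
  have "(sinh (\<bar>\<rho>\<bar> * (\<bar>t\<bar> / 2)))\<^sup>2 \<le> (\<bar>\<rho>\<bar> * sinh (\<bar>t\<bar> / 2))\<^sup>2"
    using assms by (intro power_mono sinh_mult_le) auto
  then have "cosh (\<bar>\<rho> * t\<bar>) - 1 \<le> \<rho>\<^sup>2 * (cosh \<bar>t\<bar> - 1)"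
    unfolding cosh_minus_one by (simp add: abs_mult power_mult_distrib)
  then show ?thesis by simp
qed

text \<open>The integrand of the \<alpha>-form on one edge, with the prefactor of the inequality
  included except for the constant \<open>C\<close>.\<close>

definition energy_density :: "real \<Rightarrow> real \<Rightarrow> real \<Rightarrow> real" where
  "energy_density \<alpha> u v = (if \<alpha> = 1 then 1 / 4 * ((u - v) * (ln u - ln v))
     else \<alpha> * conj_exponent \<alpha> / 4 * ((u powr (1 / \<alpha>) - v powr (1 / \<alpha>))
            * (u powr (1 / conj_exponent \<alpha>) - v powr (1 / conj_exponent \<alpha>))))"

text \<open>The two exponents add up to 1. For the test function of the lower bound this reduces
  every edge to the pair \<open>r\<close>, \<open>1\<close>.\<close>

lemma energy_density_scale:
  assumes "0 < \<alpha>" "0 < t" "0 < u" "0 < v"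
  shows "energy_density \<alpha> (t * u) (t * v) = t * energy_density \<alpha> u v"
proof (cases "\<alpha> = 1")
  case True
  then show ?thesis using assms by (simp add: energy_density_def ln_mult algebra_simps)
next
  case False
  have "1 / \<alpha> + 1 / conj_exponent \<alpha> = 1"
    using conj_exponent_iff[of \<alpha>] assms(1) False by auto
  then have "t powr (1 / \<alpha>) * t powr (1 / conj_exponent \<alpha>) = t"
    using assms(2) by (simp add: powr_add[symmetric])
  then have "(t * u) powr (1 / \<alpha>) - (t * v) powr (1 / \<alpha>) = t powr (1 / \<alpha>) * (u powr (1 / \<alpha>) - v powr (1 / \<alpha>))"
    and "(t * u) powr (1 / conj_exponent \<alpha>) - (t * v) powr (1 / conj_exponent \<alpha>) = t powr (1 / conj_exponent \<alpha>) * (u powr (1 / conj_exponent \<alpha>) - v powr (1 / conj_exponent \<alpha>))"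
    and "t = t powr (1 / \<alpha>) * t powr (1 / conj_exponent \<alpha>)"
    using assms by (simp_all add: powr_mult algebra_simps)
  then show ?thesis using False unfolding energy_density_def by (simp add: mult_ac)
qed

text \<open>Put \<open>u = exp (c + t)\<close>, \<open>v = exp (c - t)\<close> and
  \<open>\<rho> = 2 / \<alpha> - 1\<close>. The left side is
  \<open>exp c * (2 * (cosh t - 1))\<close>, the right side \<open>exp c * (2 * ((cosh t - cosh
  (\<rho> * t)) / (1 - \<rho>\<^sup>2)))\<close>, with limit \<open>exp c * (t * sinh t)\<close> at
  \<alpha> = 1. What remains is \<open>cosh_minus_one_mult_le\<close>.\<close>

lemma energy_density_ge:
  assumes \<alpha>: "0 < \<alpha>" and u: "0 < u" and v: "0 < v"
  shows "(sqrt u - sqrt v)\<^sup>2 \<le> energy_density \<alpha> u v"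
proof -
  define c t where "c = (ln u + ln v) / 2" and "t = (ln u - ln v) / 2"
  have ln_uv: "ln u = c + t" "ln v = c - t" by (simp_all add: c_def t_def field_simps)
  have uv: "u = exp c * exp t" "v = exp c * exp (- t)"
    using exp_ln[OF u] exp_ln[OF v] unfolding ln_uv by (simp_all flip: exp_add)
  have "sqrt u * sqrt v = exp c"
    unfolding real_sqrt_mult[symmetric] by (rule real_sqrt_unique) (simp_all add: uv exp_minus power2_eq_square)
  then have "(sqrt u - sqrt v)\<^sup>2 = u + v - 2 * exp c"
    using u v by (simp add: power2_diff)
  also have "\<dots> = exp c * (2 * (cosh t - 1))"
    by (simp add: cosh_def uv algebra_simps)
  also have "\<dots> \<le> energy_density \<alpha> u v"
  proof (cases "\<alpha> = 1")
    case True
    have "2 * (cosh t - 1) = 4 * (sinh (\<bar>t\<bar> / 2))\<^sup>2"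
      using cosh_minus_one[of "\<bar>t\<bar>"] by simp
    also have "\<dots> \<le> 4 * (sinh (\<bar>t\<bar> / 2) * (\<bar>t\<bar> / 2 * cosh (\<bar>t\<bar> / 2)))"
      unfolding power2_eq_square by (intro mult_left_mono sinh_le_mult_cosh) auto
    also have "\<dots> = \<bar>t\<bar> * sinh \<bar>t\<bar>"
      using sinh_double[of "\<bar>t\<bar> / 2"] by simp
    also have "\<dots> = t * sinh t" by (auto simp: abs_if)
    finally have "exp c * (2 * (cosh t - 1)) \<le> exp c * (t * sinh t)" by simp
    also have "\<dots> = energy_density \<alpha> u v"
      using True unfolding energy_density_def ln_uv by (simp add: uv sinh_def algebra_simps)
    finally show ?thesis .
  next
    case False
    define s where "s = 1 / \<alpha>"
    define \<rho> where "\<rho> = 2 * s - 1"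
    have s: "1 / \<alpha> = s" "1 / conj_exponent \<alpha> = 1 - s" "0 < s" "s \<noteq> 1"
      using \<alpha> False by (auto simp: s_def conj_exponent_def field_simps)
    have prod: "\<alpha> * conj_exponent \<alpha> / 4 = 1 / (1 - \<rho>\<^sup>2)"
    proof -
      have "\<alpha> * conj_exponent \<alpha> = 1 / (s * (1 - s))"
        using s(1)[symmetric] s(2)[symmetric] by simp
      moreover have "1 - \<rho>\<^sup>2 = 4 * (s * (1 - s))" by (simp add: \<rho>_def power2_eq_square algebra_simps)
      ultimately show ?thesis by simp
    qed
    have \<rho>: "1 - \<rho>\<^sup>2 \<noteq> 0"
      using s by (simp add: \<rho>_def power2_eq_square algebra_simps)
    have key: "cosh t - 1 \<le> (cosh t - cosh (\<rho> * t)) / (1 - \<rho>\<^sup>2)"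
    proof (cases "\<bar>\<rho>\<bar> \<le> 1")
      case True
      then have "0 < 1 - \<rho>\<^sup>2" using \<rho> by (simp add: abs_square_le_1 less_le)
      moreover have "(cosh t - 1) * (1 - \<rho>\<^sup>2) \<le> cosh t - cosh (\<rho> * t)"
        using cosh_minus_one_mult_le[OF True, of t] by (simp add: algebra_simps)
      ultimately show ?thesis by (simp only: pos_le_divide_eq)
    next
      case False
      then have "1 < \<rho>\<^sup>2" using abs_square_le_1[of \<rho>] by linarith
      \<comment> \<open>Here \<alpha> < 1. The comparison is used with \<open>1 / \<rho>\<close> at
        the point \<open>\<rho> * t\<close>, and the negative denominator
        \<open>1 - \<rho>\<^sup>2\<close> restores the direction of the inequality.\<close>
      have "cosh (1 / \<rho> * (\<rho> * t)) - 1 \<le> (1 / \<rho>)\<^sup>2 * (cosh (\<rho> * t) - 1)"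
        using False by (intro cosh_minus_one_mult_le) (simp add: field_simps)
      then have "\<rho>\<^sup>2 * (cosh t - 1) \<le> cosh (\<rho> * t) - 1"
        using False \<open>1 < \<rho>\<^sup>2\<close> by (auto simp: power_divide field_simps split: if_splits)
      then have "cosh t - cosh (\<rho> * t) \<le> (cosh t - 1) * (1 - \<rho>\<^sup>2)"
        by (simp add: algebra_simps)
      moreover have "1 - \<rho>\<^sup>2 < 0" using \<open>1 < \<rho>\<^sup>2\<close> by simp
      ultimately show ?thesis by (simp only: neg_le_divide_eq)
    qed
    have "energy_density \<alpha> u v = 1 / (1 - \<rho>\<^sup>2) *
        ((exp (s * (c + t)) - exp (s * (c - t))) * (exp ((1 - s) * (c + t)) - exp ((1 - s) * (c - t))))"
      using False u v by (simp add: energy_density_def prod s powr_def ln_uv)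
    also have "(exp (s * (c + t)) - exp (s * (c - t))) * (exp ((1 - s) * (c + t)) - exp ((1 - s) * (c - t)))
        = exp (c + t) - exp (c + \<rho> * t) - (exp (c + - (\<rho> * t)) - exp (c + - t))"
    proof -
      have "s * (c + t) + (1 - s) * (c + t) = c + t" "s * (c + t) + (1 - s) * (c - t) = c + \<rho> * t"
        "s * (c - t) + (1 - s) * (c + t) = c + - (\<rho> * t)" "s * (c - t) + (1 - s) * (c - t) = c + - t"
        by (simp_all add: \<rho>_def algebra_simps)
      then show ?thesis by (simp only: left_diff_distrib right_diff_distrib mult_exp_exp)
    qed
    also have "\<dots> = exp c * (2 * (cosh t - cosh (\<rho> * t)))"
      unfolding exp_add by (simp add: cosh_def algebra_simps)
    also have "1 / (1 - \<rho>\<^sup>2) * \<dots> = exp c * (2 * ((cosh t - cosh (\<rho> * t)) / (1 - \<rho>\<^sup>2)))" by simp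
    finally have eq: "energy_density \<alpha> u v = exp c * (2 * ((cosh t - cosh (\<rho> * t)) / (1 - \<rho>\<^sup>2)))" .
    show ?thesis unfolding eq by (intro mult_left_mono key) auto
  qed
  finally show ?thesis .
qed

text \<open>The left side vanishes to second order at \<open>u = 1\<close>. For
  \<open>u \<le> 2\<close>, \<open>ln u \<le> u - 1\<close> leaves the factor
  \<open>2 * u + 1 \<le> 5\<close>; for larger \<open>u\<close>, \<open>u \<le> 2 * (u - 1)\<close>
  and only the logarithm is not bounded by a constant.\<close>

lemma entropy_density_le:
  fixes u \<Lambda> :: real
  assumes "0 < u" "u \<le> \<Lambda>" "1 \<le> \<Lambda>"
  shows "u\<^sup>2 * ln (u\<^sup>2) - u\<^sup>2 + 1 \<le> (5 + 8 * ln \<Lambda>) * (u - 1)\<^sup>2"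
proof (cases "u \<le> 2")
  case True
  have "u\<^sup>2 * ln (u\<^sup>2) = 2 * u\<^sup>2 * ln u" using assms by (simp add: ln_realpow)
  also have "\<dots> \<le> 2 * u\<^sup>2 * (u - 1)"
    using assms ln_le_minus_one by (intro mult_left_mono) auto
  finally have "u\<^sup>2 * ln (u\<^sup>2) - u\<^sup>2 + 1 \<le> (2 * u + 1) * (u - 1)\<^sup>2"
    by (simp add: power2_eq_square algebra_simps)
  also have "\<dots> \<le> (5 + 8 * ln \<Lambda>) * (u - 1)\<^sup>2"
    using True ln_ge_zero[OF assms(3)] by (intro mult_right_mono) auto
  finally show ?thesis .
next
  case False
  have "u\<^sup>2 * ln (u\<^sup>2) - u\<^sup>2 + 1 \<le> 2 * u\<^sup>2 * ln u"
    using assms False by (simp add: ln_realpow)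
  also have "\<dots> \<le> 2 * (2 * (u - 1))\<^sup>2 * ln \<Lambda>"
    using assms False by (intro mult_mono power_mono) auto
  also have "\<dots> = 8 * ln \<Lambda> * (u - 1)\<^sup>2" unfolding power_mult_distrib by simp
  also have "\<dots> \<le> (5 + 8 * ln \<Lambda>) * (u - 1)\<^sup>2" by (intro mult_right_mono) auto
  finally show ?thesis .
qed

section \<open>Entropy against the variance of the square root\<close>

context east_interval
begin

text \<open>
  Among the constants \<open>m\<close>, the right-hand side is minimal at the mean of \<open>f\<close>; taking \<open>m\<close> to be the
  square of the mean of \<open>sqrt f\<close> instead leads to the variance of \<open>sqrt f\<close> without a Rothaus-type lemma.
\<close>

lemma entropy_le_square_mean:
  assumes "\<And>\<sigma>. \<sigma> \<in> configs a b \<Longrightarrow> 0 < f \<sigma>" "0 < m"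
  shows "east_entropy q a b f \<le> E (\<lambda>\<sigma>. f \<sigma> * ln (f \<sigma> / m) - f \<sigma> + m)"
proof -
  define M where "M = E f"
  have M: "0 < M" unfolding M_def by (intro E_pos assms)
  have "east_entropy q a b f = E (\<lambda>\<sigma>. f \<sigma> * ln (f \<sigma> / m) - f \<sigma> * ln (M / m))"
    unfolding east_entropy_def using M assms
    by (intro E_cong) (simp add: M_def[symmetric] ln_div algebra_simps)
  also have "\<dots> = E (\<lambda>\<sigma>. f \<sigma> * ln (f \<sigma> / m)) - M * ln (M / m)"
    by (simp only: E_diff E_multc M_def)
  also have "\<dots> \<le> E (\<lambda>\<sigma>. f \<sigma> * ln (f \<sigma> / m)) - M + m"
  proof -
    have "ln (m / M) \<le> m / M - 1" using M assms by (intro ln_le_minus_one) auto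
    then have "M * ln (m / M) \<le> M * (m / M - 1)" using M by (intro mult_left_mono) auto
    moreover have "ln (m / M) = - ln (M / m)" using M assms by (simp add: ln_div)
    ultimately show ?thesis using M by (simp add: right_diff_distrib)
  qed
  also have "\<dots> = E (\<lambda>\<sigma>. f \<sigma> * ln (f \<sigma> / m) - f \<sigma> + m)"
    by (simp add: E_add E_diff M_def)
  finally show ?thesis .
qed

lemma pmf_east_ge:
  assumes "\<sigma> \<in> configs a b"
  shows "min q (1 - q) ^ card {a..b} \<le> pmf (east_pmf q a b) \<sigma>"
proof -
  have "min q (1 - q) ^ card {a..b} = (\<Prod>x\<in>{a..b}. min q (1 - q))" by simp
  also have "\<dots> \<le> pmf (east_pmf q a b) \<sigma>"
    unfolding pmf_east[OF assms] using q_pos q_less_1 by (intro prod_mono) auto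
  finally show ?thesis .
qed

definition energy :: "real \<Rightarrow> ((int \<Rightarrow> bool) \<Rightarrow> real) \<Rightarrow> real" where
  "energy \<alpha> f = q * (1 - q) * (\<Sum>x\<in>{a..b}. E (\<lambda>\<sigma>. constr x \<sigma> * energy_density \<alpha> (f (\<sigma>(x := True))) (f (\<sigma>(x := False)))))"

text \<open>Merges the cases \<alpha> = 1 and \<alpha> \<noteq> 1 into one inequality linear in
  \<open>C\<close>; from here on the exponents enter only through
  \<open>energy_density\<close>.\<close>

lemma alpha_log_sobolev_iff:
  "alpha_log_sobolev q \<alpha> a b C \<longleftrightarrow>
     (\<forall>f. (\<forall>\<sigma>\<in>configs a b. 0 < f \<sigma>) \<longrightarrow> east_entropy q a b f \<le> C * energy \<alpha> f)"
proof -
  have *: "E (\<lambda>\<sigma>. constr x \<sigma> * (r * h \<sigma>)) = r * E (\<lambda>\<sigma>. constr x \<sigma> * h \<sigma>)" for x r h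
    by (simp only: mult.left_commute[of _ r] E_cmult)
  have gen: "q * (1 - q) * (\<Sum>x\<in>{a..b}. E (\<lambda>\<sigma>. constr x \<sigma> * (r * (site_diff x F \<sigma> * site_diff x G \<sigma>))))
      = r * east_dirichlet q a b F G" for r F G
    unfolding dirichlet_eq * sum_distrib_left[symmetric] by (rule mult.left_commute)
  have "(if \<alpha> = 1 then C / 4 * east_dirichlet q a b f (\<lambda>\<sigma>. ln (f \<sigma>))
           else \<alpha> * conj_exponent \<alpha> * C / 4
                  * east_dirichlet q a b (\<lambda>\<sigma>. f \<sigma> powr (1 / \<alpha>))
                                         (\<lambda>\<sigma>. f \<sigma> powr (1 / conj_exponent \<alpha>))) = C * energy \<alpha> f" for f
  proof (cases "\<alpha> = 1")
    case True
    then have "energy \<alpha> f = 1 / 4 * east_dirichlet q a b f (\<lambda>\<sigma>. ln (f \<sigma>))"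
      unfolding gen[symmetric] by (simp only: energy_def energy_density_def site_diff_def if_True simp_thms)
    then show ?thesis using True by simp
  next
    case False
    then have "energy \<alpha> f = \<alpha> * conj_exponent \<alpha> / 4 * east_dirichlet q a b (\<lambda>\<sigma>. f \<sigma> powr (1 / \<alpha>))
        (\<lambda>\<sigma>. f \<sigma> powr (1 / conj_exponent \<alpha>))"
      unfolding gen[symmetric] by (simp only: energy_def energy_density_def site_diff_def if_False simp_thms)
    then show ?thesis using False by simp
  qed
  then show ?thesis unfolding alpha_log_sobolev_def by simp
qed

text \<open>\<open>energy_density_ge\<close> on every edge. The left side is the form for \<alpha> =
  2, the weakest of all.\<close>

lemma energy_ge_dirichlet_sqrt:
  assumes "0 < \<alpha>" "\<And>\<sigma>. \<sigma> \<in> configs a b \<Longrightarrow> 0 < f \<sigma>"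
  shows "east_dirichlet q a b (\<lambda>\<sigma>. sqrt (f \<sigma>)) (\<lambda>\<sigma>. sqrt (f \<sigma>)) \<le> energy \<alpha> f"
  unfolding dirichlet_eq energy_def
proof (intro mult_left_mono sum_mono E_mono)
  fix x \<sigma> assume "x \<in> {a..b}" "\<sigma> \<in> configs a b"
  then show "site_diff x (\<lambda>\<sigma>. sqrt (f \<sigma>)) \<sigma> * site_diff x (\<lambda>\<sigma>. sqrt (f \<sigma>)) \<sigma>
      \<le> energy_density \<alpha> (f (\<sigma>(x := True))) (f (\<sigma>(x := False)))"
    unfolding site_diff_def power2_eq_square[symmetric]
    by (intro energy_density_ge assms configs_upd)
qed (use q_pos q_less_1 constr_nonneg in auto)

lemma energy_nonneg:
  assumes "0 < \<alpha>" "\<And>\<sigma>. \<sigma> \<in> configs a b \<Longrightarrow> 0 < f \<sigma>"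
  shows "0 \<le> energy \<alpha> f"
proof -
  have "0 \<le> east_dirichlet q a b (\<lambda>\<sigma>. sqrt (f \<sigma>)) (\<lambda>\<sigma>. sqrt (f \<sigma>))"
    unfolding dirichlet_eq power2_eq_square[symmetric] using q_pos q_less_1 constr_nonneg
    by (intro mult_nonneg_nonneg sum_nonneg E_nonneg) auto
  also have "\<dots> \<le> energy \<alpha> f" by (rule energy_ge_dirichlet_sqrt[OF assms])
  finally show ?thesis .
qed

lemma entropy_le_variance_sqrt:
  assumes f: "\<And>\<sigma>. \<sigma> \<in> configs a b \<Longrightarrow> 0 < f \<sigma>"
  shows "east_entropy q a b f \<le> (5 + 8 * ln (1 / min q (1 - q))) * real (card {a..b})
    * E (\<lambda>\<sigma>. (sqrt (f \<sigma>) - E (\<lambda>\<sigma>. sqrt (f \<sigma>)))\<^sup>2)"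
proof -
  define m where "m = E (\<lambda>\<sigma>. sqrt (f \<sigma>))"
  define L where "L = card {a..b}"
  define \<mu> where "\<mu> = min q (1 - q)"
  have \<mu>: "0 < \<mu>" "\<mu> \<le> 1" using q_pos q_less_1 by (auto simp: \<mu>_def)
  have L: "1 \<le> L" using a_le_b by (simp add: L_def)
  have m: "0 < m" unfolding m_def by (intro E_pos) (simp add: f)
  have pointwise: "f \<sigma> * ln (f \<sigma> / m\<^sup>2) - f \<sigma> + m\<^sup>2
      \<le> (5 + 8 * ln (1 / \<mu>)) * real L * (sqrt (f \<sigma>) - m)\<^sup>2" if \<sigma>: "\<sigma> \<in> configs a b" for \<sigma>
  proof -
    define u where "u = sqrt (f \<sigma>) / m"
    have u: "0 < u" using m f[OF \<sigma>] by (simp add: u_def)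
    have f_eq: "f \<sigma> = m\<^sup>2 * u\<^sup>2" using m f[OF \<sigma>] by (simp add: u_def power_divide)
    \<comment> \<open>A single configuration contributes at most the whole mean \<open>m\<close>, so
      \<open>u\<close> is at most exponential in \<open>L\<close>. Its logarithm produces the factor
      \<open>L\<close>.\<close>
    have "\<mu> ^ L * sqrt (f \<sigma>) \<le> pmf (east_pmf q a b) \<sigma> * sqrt (f \<sigma>)"
      using pmf_east_ge[OF \<sigma>] f[OF \<sigma>] unfolding L_def \<mu>_def by (intro mult_right_mono) auto
    also have "\<dots> \<le> m"
      unfolding m_def E_eq_sum using f by (intro member_le_sum \<sigma> finite_configs mult_nonneg_nonneg real_sqrt_ge_zero) (auto intro: less_imp_le)
    finally have "u \<le> (1 / \<mu>) ^ L" using m \<mu> by (simp add: u_def field_simps power_divide)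
    moreover have "1 \<le> (1 / \<mu>) ^ L" using \<mu> by (intro one_le_power) auto
    ultimately have "u\<^sup>2 * ln (u\<^sup>2) - u\<^sup>2 + 1 \<le> (5 + 8 * ln ((1 / \<mu>) ^ L)) * (u - 1)\<^sup>2"
      using u by (intro entropy_density_le)
    also have "ln ((1 / \<mu>) ^ L) = real L * ln (1 / \<mu>)" using \<mu> by (simp add: ln_realpow)
    also have "(5 + 8 * (real L * ln (1 / \<mu>))) * (u - 1)\<^sup>2 \<le> (5 * real L + 8 * (real L * ln (1 / \<mu>))) * (u - 1)\<^sup>2"
      using L by (intro mult_right_mono) auto
    finally have "m\<^sup>2 * (u\<^sup>2 * ln (u\<^sup>2) - u\<^sup>2 + 1) \<le> m\<^sup>2 * ((5 * real L + 8 * (real L * ln (1 / \<mu>))) * (u - 1)\<^sup>2)"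
      by (intro mult_left_mono) auto
    moreover have "f \<sigma> * ln (f \<sigma> / m\<^sup>2) - f \<sigma> + m\<^sup>2 = m\<^sup>2 * (u\<^sup>2 * ln (u\<^sup>2) - u\<^sup>2 + 1)"
      using m by (simp add: f_eq algebra_simps)
    moreover have "(sqrt (f \<sigma>) - m)\<^sup>2 = m\<^sup>2 * (u - 1)\<^sup>2"
    proof -
      have "sqrt (f \<sigma>) - m = m * (u - 1)" using m by (simp add: u_def algebra_simps)
      then show ?thesis by (simp only: power_mult_distrib)
    qed
    ultimately show ?thesis by (simp add: algebra_simps)
  qed
  have "east_entropy q a b f \<le> E (\<lambda>\<sigma>. f \<sigma> * ln (f \<sigma> / m\<^sup>2) - f \<sigma> + m\<^sup>2)"
    using m by (intro entropy_le_square_mean f) auto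
  also have "\<dots> \<le> E (\<lambda>\<sigma>. (5 + 8 * ln (1 / \<mu>)) * real L * (sqrt (f \<sigma>) - m)\<^sup>2)"
    by (intro E_mono pointwise)
  finally show ?thesis unfolding E_cmult m_def L_def \<mu>_def .
qed

end

lemma log_sobolev_upper:
  assumes "0 < q" "q < 1" "0 < \<alpha>"
  shows "\<exists>c>0. \<forall>a b. a \<le> b \<longrightarrow> alpha_log_sobolev q \<alpha> a b (c * real (card {a..b}))"
proof -
  have "(\<lambda>l. real l * (1 - q / 2) ^ l + (1 - q / 2) ^ l) \<longlonglongrightarrow> 0 + 0"
    using assms by (intro tendsto_add powser_times_n_limit_0 LIMSEQ_power_zero) auto
  then have "(\<lambda>l. (real l + 1) * (1 - q / 2) ^ l) \<longlonglongrightarrow> 0"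
    by (simp add: distrib_right)
  then have "\<forall>\<^sub>F l in sequentially. (real l + 1) * (1 - q / 2) ^ l < 1 / 2"
    by (rule order_tendstoD) simp
  \<comment> \<open>\<open>l\<close> depends on \<open>q\<close> only, hence serves all intervals at
    once; \<open>1 \<le> l\<close> keeps \<open>\<gamma>\<close> positive.\<close>
  then have "\<forall>\<^sub>F l in sequentially. (real l + 1) * (1 - q / 2) ^ l < 1 / 2 \<and> 1 \<le> l"
    by (intro eventually_conj eventually_ge_at_top)
  from eventually_happens'[OF sequentially_bot this]
  obtain l where l: "(real l + 1) * (1 - q / 2) ^ l < 1 / 2" "1 \<le> l" by blast
  define \<gamma> where "\<gamma> = 4 / q * real l * (real l + 1) * propagation_const q l"
  define K where "K = 5 + 8 * ln (1 / min q (1 - q))"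
  have "0 < propagation_const q l"
    using propagation_const_ge_1[OF assms(1,2), of l] by linarith
  then have \<gamma>: "0 < \<gamma>"
    using assms(1) l(2) unfolding \<gamma>_def by simp
  have "1 \<le> 1 / min q (1 - q)" using assms(1,2) by simp
  then have "0 \<le> ln (1 / min q (1 - q))" by (rule ln_ge_zero)
  then have K: "0 < K" unfolding K_def by linarith
  show ?thesis
  proof (intro exI[of _ "K * \<gamma>"] conjI allI impI)
    show "0 < K * \<gamma>" using K \<gamma> by simp
    fix a b :: int assume "a \<le> b"
    then interpret east_interval q a b using assms by unfold_locales
    show "alpha_log_sobolev q \<alpha> a b (K * \<gamma> * real (card {a..b}))"
      unfolding alpha_log_sobolev_iff
    proof (intro allI impI)
      fix f :: "(int \<Rightarrow> bool) \<Rightarrow> real" assume "\<forall>\<sigma>\<in>configs a b. 0 < f \<sigma>"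
      then have f: "\<And>\<sigma>. \<sigma> \<in> configs a b \<Longrightarrow> 0 < f \<sigma>" by blast
      have "east_entropy q a b f \<le> K * real (card {a..b}) * E (\<lambda>\<sigma>. (sqrt (f \<sigma>) - E (\<lambda>\<sigma>. sqrt (f \<sigma>)))\<^sup>2)"
        unfolding K_def by (rule entropy_le_variance_sqrt[OF f])
      also have "\<dots> \<le> K * real (card {a..b}) * (\<gamma> * energy \<alpha> f)"
      proof (intro mult_left_mono)
        have "E (\<lambda>\<sigma>. (sqrt (f \<sigma>) - E (\<lambda>\<sigma>. sqrt (f \<sigma>)))\<^sup>2)
            \<le> \<gamma> * east_dirichlet q a b (\<lambda>\<sigma>. sqrt (f \<sigma>)) (\<lambda>\<sigma>. sqrt (f \<sigma>))"
          unfolding \<gamma>_def using l by (intro poincare) simp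
        also have "\<dots> \<le> \<gamma> * energy \<alpha> f"
          using \<gamma> by (intro mult_left_mono energy_ge_dirichlet_sqrt f assms) auto
        finally show "E (\<lambda>\<sigma>. (sqrt (f \<sigma>) - E (\<lambda>\<sigma>. sqrt (f \<sigma>)))\<^sup>2) \<le> \<gamma> * energy \<alpha> f" .
      qed (use K in auto)
      finally show "east_entropy q a b f \<le> K * \<gamma> * real (card {a..b}) * energy \<alpha> f"
        by (simp only: mult_ac)
    qed
  qed
qed

section \<open>Log-Sobolev lower bound\<close>

definition leading_ones :: "int \<Rightarrow> int \<Rightarrow> (int \<Rightarrow> bool) \<Rightarrow> nat" where
  "leading_ones a b \<sigma> = card {x \<in> {a..b}. \<forall>y\<in>{a..x}. \<sigma> y}"

lemma leading_ones_eq: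
  assumes "a \<le> x" "x \<le> b + 1" "\<forall>y\<in>{a..<x}. \<sigma> y" "x = b + 1 \<or> \<not> \<sigma> x"
  shows "leading_ones a b \<sigma> = nat (x - a)"
proof -
  have "{w \<in> {a..b}. \<forall>y\<in>{a..w}. \<sigma> y} = {a..<x}"
  proof (intro equalityI subsetI)
    fix w assume w: "w \<in> {w \<in> {a..b}. \<forall>y\<in>{a..w}. \<sigma> y}"
    show "w \<in> {a..<x}"
    proof (rule ccontr)
      assume "w \<notin> {a..<x}"
      then have "x \<le> w" using w by auto
      then have "\<sigma> x" "x \<noteq> b + 1" using w assms(1) by auto
      then show False using assms(4) by simp
    qed
  qed (use assms in auto)
  then show ?thesis by (simp add: leading_ones_def)
qed

lemma leading_ones_first_zero:
  fixes a b :: int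
  assumes "a \<le> b"
  obtains x where "a \<le> x" "x \<le> b + 1" "\<forall>y\<in>{a..<x}. \<sigma> y" "x = b + 1 \<or> \<not> \<sigma> x"
proof (cases "\<forall>y\<in>{a..b}. \<sigma> y")
  case True
  then have "\<forall>y\<in>{a..<b + 1}. \<sigma> y" by auto
  then show ?thesis using that[of "b + 1"] assms by auto
next
  case False
  define Z where "Z = {y \<in> {a..b}. \<not> \<sigma> y}"
  have Z: "finite Z" unfolding Z_def by (rule finite_subset[of _ "{a..b}"]) auto
  moreover have "Z \<noteq> {}" using False by (auto simp: Z_def)
  ultimately have min: "Min Z \<in> Z" by simp
  have mem: "y \<in> Z \<longleftrightarrow> a \<le> y \<and> y \<le> b \<and> \<not> \<sigma> y" for y by (auto simp: Z_def)
  have "a \<le> Min Z" "Min Z \<le> b" "\<not> \<sigma> (Min Z)" using min unfolding mem by blast+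
  moreover have "\<sigma> y" if "y \<in> {a..<Min Z}" for y
  proof (rule ccontr)
    assume "\<not> \<sigma> y"
    then have "y \<in> Z" using that \<open>Min Z \<le> b\<close> unfolding mem by simp
    then have "Min Z \<le> y" using Z by simp
    then show False using that by simp
  qed
  ultimately show ?thesis using that[of "Min Z"] by simp
qed

lemma leading_ones_upd_beyond:
  assumes "a \<le> z" "z < x" "\<not> \<sigma> z"
  shows "leading_ones a b (\<sigma>(x := v)) = leading_ones a b \<sigma>"
proof -
  have "(\<forall>y\<in>{a..w}. (\<sigma>(x := v)) y) = (\<forall>y\<in>{a..w}. \<sigma> y)" for w
  proof (cases "z \<le> w")
    case True
    then have "z \<in> {a..w}" "\<not> (\<sigma>(x := v)) z" using assms by auto
    then show ?thesis using assms(3) by blast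
  next
    case False
    then have "(\<sigma>(x := v)) y = \<sigma> y" if "y \<in> {a..w}" for y using that assms(2) by auto
    then show ?thesis by (intro ball_cong refl)
  qed
  then show ?thesis unfolding leading_ones_def by simp
qed

lemma sum_power_int:
  fixes R :: real
  shows "(\<Sum>x\<in>{a..b}. R ^ nat (x - a)) = (\<Sum>k<card {a..b}. R ^ k)"
  by (rule sum.reindex_bij_witness[of _ "\<lambda>k. a + int k" "\<lambda>x. nat (x - a)"]) auto

lemma geometric_sum_le:
  fixes R :: real
  assumes "1 < R"
  shows "(\<Sum>k<n. R ^ k) \<le> R ^ n / (R - 1)"
proof -
  have "(\<Sum>k<n. R ^ k) = (R ^ n - 1) / (R - 1)" using assms by (intro geometric_sum) auto
  also have "\<dots> \<le> R ^ n / (R - 1)" using assms by (intro divide_right_mono) auto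
  finally show ?thesis .
qed

section \<open>Energy and entropy of the test function\<close>

context east_interval
begin

lemma E_all_ones:
  assumes "finite S" "S \<subseteq> {a..b}"
  shows "E (\<lambda>\<sigma>. of_bool (\<forall>y\<in>S. \<sigma> y)) = (1 - q) ^ card S"
  using assms
proof (induction S)
  case (insert x S)
  have "E (\<lambda>\<sigma>. of_bool (\<forall>y\<in>insert x S. \<sigma> y)) = E (site_mean q x (\<lambda>\<sigma>. of_bool (\<forall>y\<in>insert x S. \<sigma> y)))"
    using E_site_mean[of x] insert.prems by simp
  also have "site_mean q x (\<lambda>\<sigma>. of_bool (\<forall>y\<in>insert x S. \<sigma> y)) = (\<lambda>\<sigma>. (1 - q) * of_bool (\<forall>y\<in>S. \<sigma> y))"
  proof
    fix \<sigma>
    have "(\<forall>y\<in>S. (\<sigma>(x := True)) y) = (\<forall>y\<in>S. \<sigma> y)" using insert.hyps(2) by auto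
    then show "site_mean q x (\<lambda>\<sigma>. of_bool (\<forall>y\<in>insert x S. \<sigma> y)) \<sigma> = (1 - q) * of_bool (\<forall>y\<in>S. \<sigma> y)"
      by (simp add: site_mean_def)
  qed
  finally show ?case using insert by (simp add: E_cmult)
qed simp

text \<open>A flip at \<open>x\<close> changes the run only if all sites to its left are ones, and
  if it is legal the run length moves between \<open>x - a\<close> and \<open>x - a + 1\<close>.
  Since \<open>r * (1 - q) = R\<close>, the factor \<open>r ^ nat (x - a)\<close> times the
  probability of those ones is \<open>R ^ nat (x - a)\<close>, and a geometric sum remains.\<close>

lemma energy_leading_ones_le:
  fixes R :: real
  assumes R: "1 < R" and \<alpha>: "0 < \<alpha>"
  defines "r \<equiv> R / (1 - q)"
  shows "energy \<alpha> (\<lambda>\<sigma>. r ^ leading_ones a b \<sigma>)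
    \<le> q * (1 - q) * energy_density \<alpha> r 1 * (R ^ card {a..b} / (R - 1))"
proof -
  define f where "f \<sigma> = r ^ leading_ones a b \<sigma>" for \<sigma>
  define \<kappa> where "\<kappa> = energy_density \<alpha> r 1"
  have r: "0 < r" using R q_less_1 by (simp add: r_def)
  have \<kappa>: "0 \<le> \<kappa>"
    using energy_density_ge[OF \<alpha> r zero_less_one] zero_le_power2 unfolding \<kappa>_def by (rule order_trans[rotated])
  have pointwise: "constr x \<sigma> * energy_density \<alpha> (f (\<sigma>(x := True))) (f (\<sigma>(x := False)))
      \<le> \<kappa> * r ^ nat (x - a) * of_bool (\<forall>y\<in>{a..<x}. \<sigma> y)" if x: "x \<in> {a..b}" for x \<sigma>
  proof (cases "\<forall>y\<in>{a..<x}. \<sigma> y")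
    case False
    then obtain z where z: "a \<le> z" "z < x" "\<not> \<sigma> z" by auto
    have "f (\<sigma>(x := v)) = f \<sigma>" for v
      unfolding f_def leading_ones_upd_beyond[where \<sigma> = \<sigma>, OF z] ..
    moreover have eq: "of_bool (\<forall>y\<in>{a..<x}. \<sigma> y) = (0 :: real)"
      using False by (simp only: of_bool_def if_False)
    ultimately show ?thesis unfolding eq by (simp add: energy_density_def)
  next
    case True
    show ?thesis
    proof (cases "x = b \<or> \<not> \<sigma> (x + 1)")
      case False
      then have "constr x \<sigma> = 0" by (simp add: east_constraint_def)
      then show ?thesis using \<kappa> r by simp
    next
      case c: True
      have "leading_ones a b (\<sigma>(x := False)) = nat (x - a)"
        using True x by (intro leading_ones_eq) auto
      \<comment> \<open>The constraint enters here: the zero at \<open>x + 1\<close>, frozen if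
        \<open>x = b\<close>, stops the run right after \<open>x\<close>, so it cannot jump by more
        than one.\<close>
      moreover have "leading_ones a b (\<sigma>(x := True)) = nat (x + 1 - a)"
        using True x c by (intro leading_ones_eq) auto
      moreover have "nat (x + 1 - a) = Suc (nat (x - a))" using x by auto
      ultimately have "f (\<sigma>(x := True)) = r ^ nat (x - a) * r" "f (\<sigma>(x := False)) = r ^ nat (x - a) * 1"
        by (simp_all add: f_def)
      then have "energy_density \<alpha> (f (\<sigma>(x := True))) (f (\<sigma>(x := False))) = r ^ nat (x - a) * \<kappa>"
        unfolding \<kappa>_def using r \<alpha> by (simp only: energy_density_scale zero_less_power zero_less_one)
      moreover have "constr x \<sigma> = 1" using c by (auto simp: east_constraint_def)
      ultimately show ?thesis using True by simp
    qed
  qed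
  have "energy \<alpha> f \<le> q * (1 - q) * (\<Sum>x\<in>{a..b}. E (\<lambda>\<sigma>. \<kappa> * r ^ nat (x - a) * of_bool (\<forall>y\<in>{a..<x}. \<sigma> y)))"
    unfolding energy_def using q_pos q_less_1
    by (intro mult_left_mono sum_mono E_mono pointwise) auto
  also have "\<dots> = q * (1 - q) * (\<Sum>x\<in>{a..b}. \<kappa> * R ^ nat (x - a))"
  proof (intro arg_cong[where f = "\<lambda>s. q * (1 - q) * s"] sum.cong[OF refl])
    fix x assume x: "x \<in> {a..b}"
    have "{a..<x} \<subseteq> {a..b}" using x by auto
    then have "E (\<lambda>\<sigma>. of_bool (\<forall>y\<in>{a..<x}. \<sigma> y)) = (1 - q) ^ nat (x - a)"
      using E_all_ones[of "{a..<x}"] by simp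
    then show "E (\<lambda>\<sigma>. \<kappa> * r ^ nat (x - a) * of_bool (\<forall>y\<in>{a..<x}. \<sigma> y)) = \<kappa> * R ^ nat (x - a)"
      unfolding E_cmult using q_less_1 by (simp add: r_def power_divide)
  qed
  also have "\<dots> = q * (1 - q) * \<kappa> * (\<Sum>k<card {a..b}. R ^ k)"
    by (simp only: sum_distrib_left[symmetric] mult.assoc sum_power_int)
  also have "\<dots> \<le> q * (1 - q) * \<kappa> * (R ^ card {a..b} / (R - 1))"
    using \<kappa> q_pos q_less_1 by (intro mult_left_mono geometric_sum_le R) auto
  finally show ?thesis unfolding f_def \<kappa>_def .
qed

text \<open>The all-ones configuration alone gives \<open>R ^ L * (L * ln r)\<close> in the mean of
  \<open>f * ln f\<close>, while the mean \<open>Z\<close> of \<open>f\<close> is at most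
  \<open>R ^ L * (1 + \<epsilon>)\<close>. To leading order the difference is
  \<open>R ^ L * L * (ln r - ln R)\<close>, and \<open>ln r - ln R = - ln (1 - q)\<close>.\<close>

lemma entropy_leading_ones_ge:
  fixes R :: real
  assumes R: "1 < R"
  defines "r \<equiv> R / (1 - q)" and "\<epsilon> \<equiv> 1 / (R - 1)"
  shows "R ^ card {a..b} * real (card {a..b}) * (- ln (1 - q) - \<epsilon> * ln R - (1 + \<epsilon>) * \<epsilon>)
    \<le> east_entropy q a b (\<lambda>\<sigma>. r ^ leading_ones a b \<sigma>)"
proof -
  define f where "f \<sigma> = r ^ leading_ones a b \<sigma>" for \<sigma>
  define L where "L = card {a..b}"
  define Z where "Z = E f"
  have L: "1 \<le> L" "nat (b + 1 - a) = L" using a_le_b by (auto simp: L_def)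
  have \<epsilon>: "0 < \<epsilon>" using R by (simp add: \<epsilon>_def)
  have r: "1 < r" using R q_pos q_less_1 by (simp add: r_def field_simps)
  have f: "1 \<le> f \<sigma>" for \<sigma> unfolding f_def using r by (intro one_le_power) auto
  have Z_ge: "1 \<le> Z" using E_mono[of "\<lambda>_. 1" f] f by (simp add: Z_def)
  have pr: "(r * (1 - q)) = R" using q_less_1 by (simp add: r_def)
  have Z_le: "Z \<le> R ^ L * (1 + \<epsilon>)"
  proof -
    \<comment> \<open>The sum runs over the possible positions of the first zero,
      \<open>b + 1\<close> included; the requirement of a zero at \<open>x\<close> is
      dropped.\<close>
    have "Z \<le> E (\<lambda>\<sigma>. \<Sum>x\<in>{a..b + 1}. r ^ nat (x - a) * of_bool (\<forall>y\<in>{a..<x}. \<sigma> y))"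
      unfolding Z_def
    proof (rule E_mono)
      fix \<sigma>
      obtain x where x: "a \<le> x" "x \<le> b + 1" "\<forall>y\<in>{a..<x}. \<sigma> y" "x = b + 1 \<or> \<not> \<sigma> x"
        by (rule leading_ones_first_zero[OF a_le_b])
      have "f \<sigma> = r ^ nat (x - a) * of_bool (\<forall>y\<in>{a..<x}. \<sigma> y)"
        using leading_ones_eq[OF x] x(3) by (simp add: f_def)
      also have "\<dots> \<le> (\<Sum>x\<in>{a..b + 1}. r ^ nat (x - a) * of_bool (\<forall>y\<in>{a..<x}. \<sigma> y))"
        using x r by (intro member_le_sum[of x "{a..b+1}" "\<lambda>x. r ^ nat (x - a) * of_bool (\<forall>y\<in>{a..<x}. \<sigma> y)"]) auto
      finally show "f \<sigma> \<le> (\<Sum>x\<in>{a..b + 1}. r ^ nat (x - a) * of_bool (\<forall>y\<in>{a..<x}. \<sigma> y))" .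
    qed
    also have "\<dots> = (\<Sum>x\<in>{a..b + 1}. R ^ nat (x - a))"
      unfolding E_sum E_cmult
    proof (rule sum.cong[OF refl])
      fix x assume x: "x \<in> {a..b + 1}"
      have "{a..<x} \<subseteq> {a..b}" using x by auto
      then have "E (\<lambda>\<sigma>. of_bool (\<forall>y\<in>{a..<x}. \<sigma> y)) = (1 - q) ^ nat (x - a)"
        using E_all_ones[of "{a..<x}"] by simp
      then show "r ^ nat (x - a) * E (\<lambda>\<sigma>. of_bool (\<forall>y\<in>{a..<x}. \<sigma> y)) = R ^ nat (x - a)"
        by (simp add: pr flip: power_mult_distrib)
    qed
    also have "\<dots> = (\<Sum>k<Suc L. R ^ k)"
    proof -
      have "card {a..b + 1} = Suc L" using a_le_b by (simp add: L_def)
      then show ?thesis by (simp only: sum_power_int)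
    qed
    also have "\<dots> = (\<Sum>k<L. R ^ k) + R ^ L" by simp
    also have "\<dots> \<le> R ^ L / (R - 1) + R ^ L" by (intro add_right_mono geometric_sum_le R)
    finally show ?thesis by (simp add: \<epsilon>_def distrib_left)
  qed
  have ln_Z: "ln Z \<le> L * ln R + \<epsilon>"
  proof -
    have "ln Z \<le> ln (R ^ L * (1 + \<epsilon>))" using Z_ge Z_le by simp
    also have "\<dots> = L * ln R + ln (1 + \<epsilon>)" using R \<epsilon> by (simp add: ln_mult ln_realpow)
    also have "ln (1 + \<epsilon>) \<le> \<epsilon>" using \<epsilon> by (intro ln_add_one_self_le_self) auto
    finally show ?thesis by simp
  qed
  have "R ^ L * (L * ln r) \<le> E (\<lambda>\<sigma>. f \<sigma> * ln (f \<sigma>))"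
  proof -
    have "R ^ L * (L * ln r) = E (\<lambda>\<sigma>. (r ^ L * ln (r ^ L)) * of_bool (\<forall>y\<in>{a..b}. \<sigma> y))"
      unfolding E_cmult using E_all_ones[of "{a..b}"] r
      by (simp add: ln_realpow L_def[symmetric] pr[symmetric] power_mult_distrib del: card_atLeastAtMost_int)
    also have "\<dots> \<le> E (\<lambda>\<sigma>. f \<sigma> * ln (f \<sigma>))"
    proof (rule E_mono)
      fix \<sigma>
      show "(r ^ L * ln (r ^ L)) * of_bool (\<forall>y\<in>{a..b}. \<sigma> y) \<le> f \<sigma> * ln (f \<sigma>)"
      proof (cases "\<forall>y\<in>{a..b}. \<sigma> y")
        case True
        then have "leading_ones a b \<sigma> = L"
          using leading_ones_eq[of a "b + 1" b \<sigma>] a_le_b L by auto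
        then show ?thesis using True by (simp add: f_def)
      next
        case False
        have "0 \<le> f \<sigma> * ln (f \<sigma>)" using f[of \<sigma>] by (intro mult_nonneg_nonneg ln_ge_zero) auto
        moreover have eq: "of_bool (\<forall>y\<in>{a..b}. \<sigma> y) = (0 :: real)"
          using False by (simp only: of_bool_def if_False)
        ultimately show ?thesis unfolding eq by simp
      qed
    qed
    finally show ?thesis .
  qed
  moreover have "Z * ln Z \<le> R ^ L * (1 + \<epsilon>) * (L * ln R + \<epsilon>)"
    using Z_ge R \<epsilon> by (intro mult_mono Z_le ln_Z) auto
  moreover have "east_entropy q a b f = E (\<lambda>\<sigma>. f \<sigma> * ln (f \<sigma>)) - Z * ln Z"
  proof -
    have "east_entropy q a b f = E (\<lambda>\<sigma>. f \<sigma> * ln (f \<sigma>) - f \<sigma> * ln Z)"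
      unfolding east_entropy_def Z_def[symmetric]
    proof (rule E_cong)
      fix \<sigma>
      have "0 < f \<sigma>" "0 < Z" using f[of \<sigma>] Z_ge by auto
      then show "f \<sigma> * ln (f \<sigma> / Z) = f \<sigma> * ln (f \<sigma>) - f \<sigma> * ln Z"
        by (simp add: ln_div right_diff_distrib)
    qed
    then show ?thesis by (simp add: E_diff E_multc Z_def)
  qed
  ultimately have "R ^ L * (L * ln r) - R ^ L * (1 + \<epsilon>) * (L * ln R + \<epsilon>) \<le> east_entropy q a b f" by linarith
  moreover have "R ^ L * (L * (- ln (1 - q) - \<epsilon> * ln R - (1 + \<epsilon>) * \<epsilon>))
      \<le> R ^ L * (L * ln r - (1 + \<epsilon>) * (L * ln R + \<epsilon>))"
  proof (intro mult_left_mono)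
    have ln_r: "ln r = ln R - ln (1 - q)" using R q_less_1 by (simp add: r_def ln_div)
    \<comment> \<open>The error term without a factor \<open>L\<close> is enlarged by
      \<open>L \<ge> 1\<close>, so that the whole bound is proportional to \<open>L\<close>.\<close>
    have "1 * ((1 + \<epsilon>) * \<epsilon>) \<le> L * ((1 + \<epsilon>) * \<epsilon>)"
      using L(1) \<epsilon> by (intro mult_right_mono) auto
    then show "L * (- ln (1 - q) - \<epsilon> * ln R - (1 + \<epsilon>) * \<epsilon>) \<le> L * ln r - (1 + \<epsilon>) * (L * ln R + \<epsilon>)"
      unfolding ln_r
      by (simp add: algebra_simps)
  qed (use R in auto)
  ultimately show ?thesis unfolding f_def L_def by (simp add: algebra_simps)
qed

end

lemma log_sobolev_lower:
  assumes q: "0 < q" "q < 1" and \<alpha>: "0 < \<alpha>"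
  shows "\<exists>c>0. \<forall>a b C. a \<le> b \<longrightarrow> alpha_log_sobolev q \<alpha> a b C \<longrightarrow> c * real (card {a..b}) \<le> C"
proof -
  define l where "l = - ln (1 - q)"
  have l: "0 < l" using q by (simp add: l_def)
  \<comment> \<open>\<open>R\<close> is chosen, depending on \<open>q\<close> only, so large that
    the errors eat at most half of \<open>- ln (1 - q)\<close>.\<close>
  have "((\<lambda>R::real. 1 / (R - 1) * ln R + (1 + 1 / (R - 1)) * (1 / (R - 1))) \<longlongrightarrow> 0) at_top"
    by real_asymp
  then have "\<forall>\<^sub>F R in at_top. 1 / (R - 1) * ln R + (1 + 1 / (R - 1)) * (1 / (R - 1)) < l / 2"
    using l by (intro order_tendstoD) auto
  then have "\<forall>\<^sub>F R in at_top. 1 / (R - 1) * ln R + (1 + 1 / (R - 1)) * (1 / (R - 1)) < l / 2 \<and> 1 < R"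
    by (intro eventually_conj eventually_gt_at_top)
  from eventually_happens'[OF trivial_limit_at_top_linorder this]
  obtain R :: real where R: "1 / (R - 1) * ln R + (1 + 1 / (R - 1)) * (1 / (R - 1)) < l / 2" "1 < R"
    by blast
  define r where "r = R / (1 - q)"
  \<comment> \<open>The added 1 makes \<open>M\<close> positive knowing only that the energy density
    is nonnegative.\<close>
  define M where "M = q * (1 - q) * energy_density \<alpha> r 1 / (R - 1) + 1"
  have r: "0 < r" using R(2) q by (simp add: r_def)
  have "0 \<le> (sqrt r - sqrt 1)\<^sup>2" by simp
  also have "\<dots> \<le> energy_density \<alpha> r 1" by (intro energy_density_ge \<alpha> r) simp
  finally have "0 \<le> q * (1 - q) * energy_density \<alpha> r 1 / (R - 1)"
    using q R(2) by (intro divide_nonneg_nonneg mult_nonneg_nonneg) auto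
  then have M: "0 < M" unfolding M_def by linarith
  show ?thesis
  proof (intro exI[of _ "l / 2 / M"] conjI allI impI)
    show "0 < l / 2 / M" using l M by simp
    fix a b :: int and C :: real assume "a \<le> b" and C: "alpha_log_sobolev q \<alpha> a b C"
    then interpret east_interval q a b using q by unfold_locales
    define L where "L = card {a..b}"
    define f where "f \<sigma> = r ^ leading_ones a b \<sigma>" for \<sigma>
    have L: "1 \<le> L" using \<open>a \<le> b\<close> by (simp add: L_def)
    have f: "\<forall>\<sigma>\<in>configs a b. 0 < f \<sigma>" using r by (simp add: f_def)
    have energy0: "0 \<le> energy \<alpha> f" using f by (intro energy_nonneg \<alpha>) auto
    have "energy \<alpha> f \<le> q * (1 - q) * energy_density \<alpha> r 1 * (R ^ L / (R - 1))"
      unfolding f_def r_def L_def by (rule energy_leading_ones_le[OF R(2) \<alpha>])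
    also have "\<dots> = (M - 1) * R ^ L" by (simp add: M_def)
    also have "\<dots> \<le> M * R ^ L" using R(2) by (intro mult_right_mono) auto
    finally have energy: "energy \<alpha> f \<le> M * R ^ L" .
    have "R ^ L * real L * (l / 2) \<le> R ^ L * real L * (l - 1 / (R - 1) * ln R - (1 + 1 / (R - 1)) * (1 / (R - 1)))"
      using R by (intro mult_left_mono) auto
    also have "\<dots> \<le> east_entropy q a b f"
      unfolding f_def r_def L_def l_def by (rule entropy_leading_ones_ge[OF R(2)])
    also have "\<dots> \<le> C * energy \<alpha> f"
      using C f unfolding alpha_log_sobolev_iff by blast
    finally have le: "R ^ L * real L * (l / 2) \<le> C * energy \<alpha> f" .
    \<comment> \<open>Positive entropy and nonnegative energy force \<open>C > 0\<close>, which is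
      needed before the energy may be replaced by its upper bound. Then \<open>R ^ L\<close>
      cancels.\<close>
    have "0 < R ^ L * real L * (l / 2)" using R(2) L l by simp
    then have "0 < C * energy \<alpha> f" using le by linarith
    then have "0 < C" using energy0 by (simp add: zero_less_mult_iff)
    then have "C * energy \<alpha> f \<le> C * (M * R ^ L)" using energy by (intro mult_left_mono) auto
    with le have "R ^ L * (real L * (l / 2)) \<le> R ^ L * (C * M)" by (simp add: mult_ac)
    then have "real L * (l / 2) \<le> C * M" using R(2) by simp
    then show "l / 2 / M * real (card {a..b}) \<le> C"
      using M unfolding L_def[symmetric] by (simp add: pos_divide_le_eq mult.commute)
  qed
qed

section \<open>Existence and order of magnitude of the smallest constant\<close>

theorem theorem3p4:
  fixes q \<alpha> :: real
  assumes "0 < q" "q < 1" "0 < \<alpha>" "\<alpha> \<le> 2"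
  shows "\<exists>c::real. c > 0 \<and>
    (\<forall>a b::int. a \<le> b \<longrightarrow>
      (\<exists>C. best_log_sobolev_const q \<alpha> a b C \<and>
           1 / c * real (card {a..b}) \<le> C \<and> C \<le> c * real (card {a..b})))"
proof -
  obtain c1 where c1: "0 < c1" "\<And>a b. a \<le> b \<Longrightarrow> alpha_log_sobolev q \<alpha> a b (c1 * real (card {a..b}))"
    using log_sobolev_upper[OF assms(1-3)] by blast
  obtain c2 where c2: "0 < c2" "\<And>a b C. a \<le> b \<Longrightarrow> alpha_log_sobolev q \<alpha> a b C \<Longrightarrow> c2 * real (card {a..b}) \<le> C"
    using log_sobolev_lower[OF assms(1-3)] by blast
  define c where "c = max c1 (1 / c2)"
  have c: "0 < c" "c1 \<le> c" "1 / c \<le> c2"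
    using c1(1) c2(1) by (auto simp: c_def field_simps max_def)
  show ?thesis
  proof (rule exI[of _ c], intro conjI allI impI)
    fix a b :: int assume ab: "a \<le> b"
    then interpret east_interval q a b using assms by unfold_locales
    \<comment> \<open>The smallest constant is the infimum of the admissible ones: nonempty by the
      upper bound, bounded below by the lower bound.\<close>
    define S where "S = {C. alpha_log_sobolev q \<alpha> a b C}"
    have upper: "c1 * real (card {a..b}) \<in> S" using c1(2)[OF ab] by (simp add: S_def)
    have lower: "c2 * real (card {a..b}) \<le> C" if "C \<in> S" for C
      using c2(2)[OF ab] that by (simp add: S_def)
    have bdd: "bdd_below S" using lower by (rule bdd_belowI)
    have Inf_le: "Inf S \<le> C" if "C \<in> S" for C using that bdd by (rule cInf_lower)
    have "east_entropy q a b f \<le> Inf S * energy \<alpha> f" if f: "\<forall>\<sigma>\<in>configs a b. 0 < f \<sigma>" for f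
    proof -
      have le: "east_entropy q a b f \<le> C * energy \<alpha> f" if "C \<in> S" for C
        using that f unfolding S_def alpha_log_sobolev_iff by blast
      have "0 \<le> energy \<alpha> f" using f by (intro energy_nonneg assms) auto
      \<comment> \<open>The infimum is itself admissible: if the energy vanishes the inequality does
        not depend on \<open>C\<close>; otherwise it bounds \<open>C\<close> below by a quotient,
        and this passes to the infimum.\<close>
      then consider "energy \<alpha> f = 0" | "0 < energy \<alpha> f" by linarith
      then show ?thesis
      proof cases
        case 1
        then show ?thesis using le[OF upper] by simp
      next
        case 2
        have "east_entropy q a b f / energy \<alpha> f \<le> Inf S"
          using upper le 2 by (intro cInf_greatest) (auto simp: pos_divide_le_eq)
        then show ?thesis using 2 by (simp only: pos_divide_le_eq)
      qed
    qed
    then have "best_log_sobolev_const q \<alpha> a b (Inf S)"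
      using Inf_le unfolding best_log_sobolev_const_def alpha_log_sobolev_iff[of \<alpha> "Inf S"] by (simp add: S_def)
    moreover have "1 / c * real (card {a..b}) \<le> Inf S"
    proof -
      have "1 / c * real (card {a..b}) \<le> c2 * real (card {a..b})"
        using c(3) by (intro mult_right_mono) auto
      also have "\<dots> \<le> Inf S" using upper lower by (intro cInf_greatest) auto
      finally show ?thesis .
    qed
    moreover have "Inf S \<le> c * real (card {a..b})"
    proof -
      have "Inf S \<le> c1 * real (card {a..b})" by (rule Inf_le[OF upper])
      also have "\<dots> \<le> c * real (card {a..b})" using c(2) by (intro mult_right_mono) auto
      finally show ?thesis .
    qed
    ultimately show "\<exists>C. best_log_sobolev_const q \<alpha> a b C \<and>
           1 / c * real (card {a..b}) \<le> C \<and> C \<le> c * real (card {a..b})" by blast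
  qed (rule c(1))
qed

end
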